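(* Let $s_0 \ge 0$ and $s_j > 0$ for $j \ge 1$. For every $k>0$ and every $0 \le j <k$, the string $M[s_j,\ldots,s_k]$ is a discrete string.
   Context: ${\mathbb M}$ is the set of functions $M : [0,\infty] \to [0,\infty]$ that are non-decreasing, right-continuous and satisfy $M(\infty)=\infty$; elements of ${\mathbb M}$ are called strings. By convention $M(0-)=0$, so that $dM$ includes an atom of mass $M(0)$ at $0$. Put $L := \sup\{x\in[0,\infty) : M(x)<\infty\}$ (with $\sup\emptyset=0$). A string is called discrete if it is made up of a (finite or infinite) sequence of point masses $m_i$ at positions $x_i$, i.e. on $[0,L)$ it is a piecewise constant function, the measure $dM$ being there a linear combination of Dirac masses; when $L<\infty$ there is in addition a point of infinite mass at $L$ (i.e. $M=\infty$ on $[L,\infty]$). Characteristic function. For $z<0$ let $\varphi(\cdot,z)$ and $\psi(\cdot,z)$ be the solutions on $[0,L)$ of the string equation $y''+zM'y=0$ with $\varphi(0,z)=1$, $\varphi'(0-,z)=0$ and $\psi(0,z)=0$, $\psi'(0-,z)=1$; i.e. $$ \varphi(x,z) = 1 - z\int_{[0,x]} (x-t)\varphi(t,z)\,dM(t), \qquad \psi(x,z) = x - z\int_{[0,x]} (x-t)\psi(t,z)\,dM(t). $$ The characteristic function of $M$ is $W(z) := \lim_{x\to L-} \psi(x,z)/\varphi(x,z)$ for $z<0$ (with $W\equiv0$ if $L=0$), extended to ${\mathbb C}\setminus[0,\infty)$ by analytic continuation. By a known theorem conjectured by Krein, $M\mapsto W$ is a bijection from ${\mathbb M}$ onto the set ${\mathbb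 W}$ of functions $W(z) = c + \int_{[0,\infty)} \frac{d\sigma(\lambda)}{\lambda-z}$ with $c\ge0$ and $\sigma$ right-continuous non-decreasing with support in $[0,\infty)$ and $\int_{[0,\infty)}\frac{d\sigma(\lambda)}{1+\lambda}<\infty$ (the degenerate function $W\equiv\infty$, corresponding to $M\equiv 0$ on $[0,\infty)$, being included). Finite continued fractions. With $s_0\ge0$ and $s_i>0$ for $i\geq 1$, define $W[s_j] := \frac{s_j}{-z}$ and, more generally, $$ W[s_j,\ldots,s_{j+2 k}] := \frac{s_j}{-z} + \frac{1}{\displaystyle s_{j+1}+ \frac{1}{\displaystyle \frac{s_{j+2}}{-z}+ \cdots + \frac{1}{\displaystyle s_{j+2k-1}+ \frac{1}{\displaystyle \frac{s_{j+2k}}{-z}}}}} $$ and $$ W[s_j,\ldots,s_{j+2k+1}] := \frac{s_j}{-z} + \frac{1}{\displaystyle s_{j+1}+ \frac{1}{\displaystyle \frac{s_{j+2}}{-z}+ \cdots + \frac{1}{\displaystyle s_{j+2k-1}+ \frac{1}{\displaystyle \frac{s_{j+2k}}{-z}+\frac{1}{\displaystyle s_{j+2k+1}}}}}} , $$ so that terms of the form $\frac{s_i}{-z}$ and $s_i$ alternate, starting with $\frac{s_j}{-z}$, whatever the parity of $j$ (e.g. $W[s_j,s_{j+1}] = \frac{s_j}{-z}+\frac{1}{s_{j+1}}$). These functions belong to ${\mathbb W}$, and $M[s_j,\ldots,s_k]$ denotes the string with characteristic function $W[s_j,\ldots,s_k]$. *)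

theory Defs
  imports "HOL-Complex_Analysis.Complex_Analysis" "HOL-Probability.Probability"
begin

definition is_string :: "(ennreal \<Rightarrow> ennreal) \<Rightarrow> bool" where
  "is_string M \<longleftrightarrow> mono M \<and> (\<forall>x. continuous (at_right x) M) \<and> M \<infinity> = \<infinity>"

definition string_length :: "(ennreal \<Rightarrow> ennreal) \<Rightarrow> ennreal" where
  "string_length M = Sup {x. x < \<infinity> \<and> M x < \<infinity>}"

text \<open>
  The restriction of \<open>dM\<close> to \<open>[0,x]\<close>, for \<open>x\<close> below the length of the string.  It is the
  Lebesgue-Stieltjes measure of \<open>M\<close> stopped at \<open>x\<close>, so that the distribution function is
  finite everywhere; being zero on the negative axis, that function has a jump \<open>M 0\<close> at \<open>0\<close>.
\<close>
definition string_measure :: "(ennreal \<Rightarrow> ennreal) \<Rightarrow> real \<Rightarrow> real measure" where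
  "string_measure M x =
     interval_measure (\<lambda>t. if t < 0 then 0 else enn2real (M (ennreal (min t x))))"

text \<open>
  \<open>string_solution M a b z f\<close>: on \<open>[0,L)\<close>, \<open>f\<close> solves \<open>y'' + z M' y = 0\<close> with \<open>y(0) = a\<close> and
  \<open>y'(0-) = b\<close>, in integrated form.  Integrability is required explicitly, as the Bochner
  integral of a non-integrable function is \<open>0\<close>.
\<close>
definition string_solution ::
  "(ennreal \<Rightarrow> ennreal) \<Rightarrow> real \<Rightarrow> real \<Rightarrow> real \<Rightarrow> (real \<Rightarrow> real) \<Rightarrow> bool" where
  "string_solution M a b z f \<longleftrightarrow>
     (\<forall>x\<ge>0. ennreal x < string_length M \<longrightarrow>
        set_integrable (string_measure M x) {0..x} (\<lambda>t. (x - t) * f t) \<and>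
        f x = a + b * x - z * (LINT t:{0..x}|string_measure M x. (x - t) * f t))"

text \<open>
  \<open>W\<close> is the characteristic function of \<open>M\<close>: it is analytic off \<open>[0,\<infinity>)\<close>, and on the negative
  axis it is the limit of \<open>\<psi>/\<phi>\<close>.  The values of \<open>W\<close> on \<open>[0,\<infinity>)\<close> are irrelevant.  Since \<open>W\<close> is
  finite-valued, no \<open>W\<close> is related to the degenerate string \<open>M = 0\<close> on \<open>[0,\<infinity>)\<close>, whose
  characteristic function is identically infinite.  The variable \<open>x\<close> of the limit ranges over
  the extended half-line, so that \<open>at_left\<close> also covers strings of infinite length.
\<close>
definition has_characteristic_function ::
  "(ennreal \<Rightarrow> ennreal) \<Rightarrow> (complex \<Rightarrow> complex) \<Rightarrow> bool" where
  "has_characteristic_function M W \<longleftrightarrow>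
     W holomorphic_on (- (complex_of_real ` {0..})) \<and>
     (\<forall>z::real. z < 0 \<longrightarrow>
        (if string_length M = 0 then W (complex_of_real z) = 0
         else \<exists>\<phi> \<psi>. string_solution M 1 0 z \<phi> \<and> string_solution M 0 1 z \<psi> \<and>
                ((\<lambda>x. complex_of_real (\<psi> (enn2real x) / \<phi> (enn2real x)))
                   \<longlongrightarrow> W (complex_of_real z)) (at_left (string_length M))))"

definition string_of :: "(complex \<Rightarrow> complex) \<Rightarrow> (ennreal \<Rightarrow> ennreal)" where
  "string_of W = (THE M. is_string M \<and> has_characteristic_function M W)"

text \<open>
  The index set \<open>I\<close> is finite or infinite.  A piecewise constant function has finitely many
  pieces on each \<open>[0,t]\<close> with \<open>t < L\<close>, so the masses may accumulate only at \<open>L\<close>.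
\<close>
definition discrete_string :: "(ennreal \<Rightarrow> ennreal) \<Rightarrow> bool" where
  "discrete_string M \<longleftrightarrow> is_string M \<and>
     (\<exists>(I :: nat set) (x :: nat \<Rightarrow> real) (m :: nat \<Rightarrow> real).
        (\<forall>i\<in>I. 0 \<le> x i \<and> ennreal (x i) < string_length M \<and> 0 < m i) \<and>
        inj_on x I \<and>
        (\<forall>t\<ge>0. ennreal t < string_length M \<longrightarrow>
           finite {i\<in>I. x i \<le> t} \<and>
           M (ennreal t) = ennreal (\<Sum>i\<in>{i\<in>I. x i \<le> t}. m i))) \<and>
     (\<forall>y\<ge>string_length M. M y = \<infinity>)"

text \<open>The continued fraction \<open>W[a, b, c, ...]\<close>; unspecified for the empty list.\<close>
fun cfrac_W :: "real list \<Rightarrow> complex \<Rightarrow> complex" where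
  "cfrac_W [a] z = complex_of_real a / (- z)"
| "cfrac_W [a, b] z = complex_of_real a / (- z) + 1 / complex_of_real b"
| "cfrac_W (a # b # c # cs) z =
     complex_of_real a / (- z) + 1 / (complex_of_real b + 1 / cfrac_W (c # cs) z)"

definition cfrac_M :: "real list \<Rightarrow> (ennreal \<Rightarrow> ennreal)" where
  "cfrac_M ss = string_of (cfrac_W ss)"

end

theory Submission
  imports Defs "HOL-Real_Asymp.Real_Asymp"
begin

text \<open>
  The string belonging to a function is singled out by a definite description, so two things are
  needed for a continued fraction \<open>W\<close>: some discrete string has characteristic function \<open>W\<close>, and no
  other string of any kind has it.

  \<^bold>\<open>Uniqueness.\<close> Fix \<open>z = -t < 0\<close>. The solutions \<open>\<phi>\<close>, \<open>\<psi>\<close> have constant Wronskian, and a solution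
  whose value and slope are nonnegative at one point stays nonnegative to the right of it. Hence
  \<open>\<psi>/\<phi>\<close> increases to \<open>W(-t)\<close>, while \<open>\<psi>'/\<phi>'\<close> at every point is an upper bound of \<open>W(-t)\<close>
  (\<open>characteristic_function_bounds\<close>). So if \<open>M\<close> and \<open>N\<close> have the same \<open>W\<close>, then
  \<open>\<psi>/\<phi>\<close> for one string, at any point, is at most \<open>\<psi>'/\<phi>'\<close> for the other, at any point. Let \<open>N\<close> be discrete
  and let \<open>p\<close> be the infimum of the points where \<open>M\<close> and \<open>N\<close> differ. To the left of \<open>p\<close> the two strings have
  the same solutions, so the Wronskian allows one to restart the comparison at \<open>p\<close>, where \<open>N\<close> has at
  most one atom followed by a gap. If \<open>M\<close> has more mass than \<open>N\<close> at \<open>p\<close> or immediately to the right of it, its solutions are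
  too stiff as \<open>t\<close> grows; if it has a smaller atom at \<open>p\<close>, they are not stiff enough. Either way one suitable value
  of \<open>t\<close> contradicts one of the two inequalities (\<open>no_first_difference\<close>). Strings of different length are told
  apart by the strict monotonicity of \<open>\<psi>/\<phi>\<close> (\<open>no_length_mismatch\<close>).

  \<^bold>\<open>Existence.\<close> For finitely many point masses \<open>m\<^sub>i\<close> separated by lengths \<open>l\<^sub>i\<close>, the function \<open>W\<close> is the
  Stieltjes continued fraction \<open>l\<^sub>1 + 1/(t m\<^sub>1 + 1/(l\<^sub>2 + \<dots>))\<close>. The fractions of the theorem have their terms in
  another order: they arise from shorter ones by \<open>W \<mapsto> 1/(b + 1/W)\<close> and \<open>W \<mapsto> a/t + W\<close>. Both operations act on strings,
  the first by the projective change of variable \<open>x \<mapsto> x/(1 + b x)\<close> with masses multiplied by \<open>(1 + b x)\<^sup>2\<close>, the second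
  by the dual change \<open>M \<mapsto> M/(1 + a M)\<close> with lengths multiplied by \<open>(1 + a M)\<^sup>2\<close>, and both preserve finite sets of
  point masses (\<open>admittance_affine_transform\<close>, \<open>impedance_affine_transform\<close>). Analyticity of the fraction off \<open>[0,\<infinity>)\<close>
  holds because all its partial denominators remain in a half-plane after multiplication by \<open>\<surd>(-z)\<close> or its
  inverse (\<open>cfrac_W_sector\<close>).
\<close>

section \<open>The measures of a string\<close>

lemma distribution_function_at_bot:
  fixes F :: "real \<Rightarrow> real"
  assumes "\<And>x. x < 0 \<Longrightarrow> F x = 0"
  shows "(F \<longlongrightarrow> 0) at_bot"
  by (rule tendsto_eventually) (use assms eventually_at_bot_linorder in \<open>force intro: exI[of _ "-1"]\<close>)

lemma finite_borel_measure_density_indicator: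
  assumes "finite_borel_measure \<mu>" "B \<in> sets borel"
  shows "finite_borel_measure (density \<mu> (indicator B))"
    and "cdf (density \<mu> (indicator B)) x = measure \<mu> (B \<inter> {..x})"
proof -
  interpret finite_borel_measure \<mu> by fact
  have B: "B \<in> sets \<mu>" using assms(2) by (simp add: M_is_borel)
  have e: "emeasure (density \<mu> (indicator B)) A = emeasure \<mu> (B \<inter> A)" if "A \<in> sets borel" for A
    using that B assms(2) by (subst emeasure_density) (auto simp: M_is_borel indicator_inter_arith[symmetric] intro!: borel_measurable_indicator)
  show "finite_borel_measure (density \<mu> (indicator B))"
    by (intro finite_borel_measure.intro finite_measureI finite_borel_measure_axioms.intro)
      (use e[of UNIV] in \<open>simp_all add: borel_UNIV M_is_borel\<close>)
  show "cdf (density \<mu> (indicator B)) x = measure \<mu> (B \<inter> {..x})"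
    unfolding cdf_def measure_def by (subst e) auto
qed

text \<open>
  The measures attached to different stopping points, or to different strings, are only comparable
  on an initial piece \<open>B\<close> of the line; cutting both off outside \<open>B\<close> makes them equal, since they
  then have the same distribution function.
\<close>

lemma integral_eq_of_measures_agree_on:
  fixes h :: "real \<Rightarrow> real"
  assumes "finite_borel_measure \<mu>" "finite_borel_measure \<nu>" "B \<in> sets borel"
    and agree: "\<And>x. measure \<mu> (B \<inter> {..x}) = measure \<nu> (B \<inter> {..x})"
    and h: "\<And>x. x \<notin> B \<Longrightarrow> h x = 0"
  shows "integrable \<mu> h \<longleftrightarrow> integrable \<nu> h" "integral\<^sup>L \<mu> h = integral\<^sup>L \<nu> h"
proof -
  have sets: "sets \<mu> = sets borel" "sets \<nu> = sets borel"
    using assms(1,2) by (auto simp: finite_borel_measure.M_is_borel)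
  have eq: "density \<mu> (indicator B) = density \<nu> (indicator B)"
    by (rule cdf_unique')
      (use assms in \<open>auto simp: finite_borel_measure_density_indicator fun_eq_iff\<close>)
  have ih: "(\<lambda>x. indicator B x *\<^sub>R h x) = h" using h by (auto simp: indicator_def fun_eq_iff)
  have meas: "borel_measurable \<mu> = (borel_measurable borel :: (real \<Rightarrow> real) set)"
     "borel_measurable \<nu> = (borel_measurable borel :: (real \<Rightarrow> real) set)"
    using sets by (auto intro: measurable_cong_sets)
  have ind: "(indicator B :: real \<Rightarrow> real) \<in> borel_measurable borel" using assms(3) by simp
  have *: "integrable \<xi> h \<longleftrightarrow> h \<in> borel_measurable borel \<and> integrable (density \<xi> (indicator B)) h"
     "h \<in> borel_measurable borel \<Longrightarrow> integral\<^sup>L \<xi> h = integral\<^sup>L (density \<xi> (indicator B)) h"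
    if "borel_measurable \<xi> = (borel_measurable borel :: (real \<Rightarrow> real) set)" for \<xi>
    using integrable_density[of h \<xi> "indicator B"] integral_density[of h \<xi> "indicator B"] that ind ih
      borel_measurable_integrable[of \<xi> h]
    by (auto simp: ennreal_indicator)
  show 1: "integrable \<mu> h \<longleftrightarrow> integrable \<nu> h"
    using *(1)[OF meas(1)] *(1)[OF meas(2)] eq by simp
  show "integral\<^sup>L \<mu> h = integral\<^sup>L \<nu> h"
    using *[OF meas(1)] *[OF meas(2)] eq 1 not_integrable_integral_eq by metis
qed

definition stopped_cdf :: "(ennreal \<Rightarrow> ennreal) \<Rightarrow> real \<Rightarrow> real \<Rightarrow> real" where
  "stopped_cdf M x = (\<lambda>t. if t < 0 then 0 else enn2real (M (ennreal (min t x))))"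

lemma finite_below_string_length:
  assumes "is_string M" "x < string_length M"
  shows "M x < \<infinity>"
proof -
  obtain y where "x < y" "M y < \<infinity>" using assms(2) unfolding string_length_def less_Sup_iff by auto
  moreover have "M x \<le> M y" using \<open>x < y\<close> assms(1) by (simp add: is_string_def monoD)
  ultimately show ?thesis by simp
qed

text \<open>
  At the length itself this is a consequence of right-continuity: a finite value there would force
  finite values a little further to the right.
\<close>

lemma infinite_from_string_length:
  assumes "is_string M" "string_length M \<le> y"
  shows "M y = \<infinity>"
proof (rule ccontr)
  assume fin: "M y \<noteq> \<infinity>"
  have mono: "mono M" and top: "M \<infinity> = \<infinity>" using assms(1) by (auto simp: is_string_def)
  have y: "y < \<infinity>" using fin top by (cases "y = \<infinity>") (auto simp: top.not_eq_extremum)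
  have "((M \<longlongrightarrow> M y) (at_right y))" using assms(1) by (simp add: is_string_def continuous_within)
  moreover have "M y < \<infinity>" using fin by (simp add: top.not_eq_extremum)
  ultimately have "eventually (\<lambda>x. M x < \<infinity>) (at_right y)" by (rule order_tendstoD)
  then obtain b where b: "b > y" "\<And>x. y < x \<Longrightarrow> x < b \<Longrightarrow> M x < \<infinity>"
    using y by (subst (asm) eventually_at_right[where y=\<infinity>]) auto
  obtain x where x: "y < x" "x < b" using dense b(1) by blast
  then have "x < \<infinity>" using less_le_trans top_greatest by (metis infinity_ennreal_def)
  with b x have "x \<le> string_length M" unfolding string_length_def by (intro Sup_upper) auto
  with x assms(2) show False by simp
qed

lemma stopped_cdf_props:
  assumes M: "is_string M" and X: "0 \<le> X" "ennreal X < string_length M"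
  shows "\<And>x y. x \<le> y \<Longrightarrow> stopped_cdf M X x \<le> stopped_cdf M X y"
    and "\<And>a. continuous (at_right a) (stopped_cdf M X)"
    and "(stopped_cdf M X \<longlongrightarrow> 0) at_bot"
    and "(stopped_cdf M X \<longlongrightarrow> enn2real (M (ennreal X))) at_top"
proof -
  have mono: "mono M" using M by (auto simp: is_string_def)
  have fin: "M (ennreal X) < \<infinity>" using finite_below_string_length[OF M X(2)] .
  have fin': "M (ennreal (min t X)) < \<infinity>" for t
    using monoD[OF mono, of "ennreal (min t X)" "ennreal X"] fin
    by (meson ennreal_leI le_less_trans min.cobounded2)
  show "stopped_cdf M X x \<le> stopped_cdf M X y" if "x \<le> y" for x y
    using that unfolding stopped_cdf_def
    by (auto intro!: enn2real_mono monoD[OF mono] ennreal_leI fin' min.mono simp flip: infinity_ennreal_def)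
  show "(stopped_cdf M X \<longlongrightarrow> 0) at_bot"
    by (rule distribution_function_at_bot) (simp add: stopped_cdf_def)
  show "(stopped_cdf M X \<longlongrightarrow> enn2real (M (ennreal X))) at_top"
    by (rule tendsto_eventually, rule eventually_at_top_linorderI[of X])
      (use X in \<open>auto simp: stopped_cdf_def min_def\<close>)
  show "continuous (at_right a) (stopped_cdf M X)" for a
  proof -
    consider "a < 0" | "a \<ge> X" | "0 \<le> a" "a < X" by linarith
    then show ?thesis unfolding continuous_within
    proof cases
      case 1
      have "eventually (\<lambda>x. stopped_cdf M X x = 0) (at_right a)"
        using 1 by (subst eventually_at_right[where y=0]) (auto simp: stopped_cdf_def intro!: exI[of _ 0])
      with 1 show "(stopped_cdf M X \<longlongrightarrow> stopped_cdf M X a) (at_right a)"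
        by (simp add: stopped_cdf_def tendsto_eventually)
    next
      case 2
      have "eventually (\<lambda>x. stopped_cdf M X x = stopped_cdf M X a) (at_right a)"
        using 2 X by (subst eventually_at_right[where y="a+1"]) (auto simp: stopped_cdf_def min_def intro!: exI[of _ "a+1"])
      then show "(stopped_cdf M X \<longlongrightarrow> stopped_cdf M X a) (at_right a)"
        by (rule tendsto_eventually)
    next
      case 3
      have c: "((\<lambda>x. ennreal (min x X)) \<longlongrightarrow> ennreal (min a X)) (at_right a)"
        by (intro tendsto_intros)
      have "eventually (\<lambda>x. ennreal (min x X) \<in> {ennreal a<..} \<and> ennreal (min x X) \<noteq> ennreal a) (at_right a)"
        using 3 by (subst eventually_at_right[where y=X]) (auto simp: min_def ennreal_less_iff intro!: exI[of _ X])
      then have f: "filterlim (\<lambda>x. ennreal (min x X)) (at_right (ennreal a)) (at_right a)"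
        using c 3 unfolding filterlim_at by (auto simp: min_def elim: eventually_mono)
      have "((M \<longlongrightarrow> M (ennreal a)) (at_right (ennreal a)))"
        using M by (simp add: is_string_def continuous_within)
      from filterlim_compose[OF this f]
      have "((\<lambda>x. M (ennreal (min x X))) \<longlongrightarrow> ennreal (enn2real (M (ennreal a)))) (at_right a)"
        using fin'[of a] 3 by (simp add: min_def)
      then have "((\<lambda>x. enn2real (M (ennreal (min x X)))) \<longlongrightarrow> enn2real (M (ennreal a))) (at_right a)"
        by (rule tendsto_enn2real) simp
      moreover have "eventually (\<lambda>x. enn2real (M (ennreal (min x X))) = stopped_cdf M X x) (at_right a)"
        using 3 by (subst eventually_at_right[where y="a+1"]) (auto simp: stopped_cdf_def intro!: exI[of _ "a+1"])
      ultimately show "(stopped_cdf M X \<longlongrightarrow> stopped_cdf M X a) (at_right a)"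
        using 3 by (subst (asm) tendsto_cong) (auto simp: stopped_cdf_def min_def)
    qed
  qed
qed

lemma string_measure_eq: "string_measure M X = interval_measure (stopped_cdf M X)"
  by (simp add: string_measure_def stopped_cdf_def)

lemma
  assumes M: "is_string M" and X: "0 \<le> X" "ennreal X < string_length M"
  shows finite_borel_measure_string: "finite_borel_measure (string_measure M X)"
    and cdf_string_measure: "cdf (string_measure M X) = stopped_cdf M X"
  unfolding string_measure_eq
  using stopped_cdf_props[OF assms]
  by (auto intro!: finite_borel_measure_interval_measure cdf_interval_measure)

text \<open>
  Integrals up to \<open>X\<close> may be computed with any later stopping point. Thus one measure serves for the
  string equation at all points of a compact interval.
\<close>

lemma string_integral_agree_closed:
  assumes M: "is_string M" and X: "0 \<le> X" "X \<le> X'" "ennreal X' < string_length M"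
    and h: "\<And>x. x > X \<Longrightarrow> h x = (0::real)"
  shows "integrable (string_measure M X) h \<longleftrightarrow> integrable (string_measure M X') h"
    and "integral\<^sup>L (string_measure M X) h = integral\<^sup>L (string_measure M X') h"
proof -
  have X1: "ennreal X < string_length M" using X by (meson ennreal_leI le_less_trans)
  note fb = finite_borel_measure_string[OF M X(1) X1]  finite_borel_measure_string[OF M _ X(3)]
  have eq: "measure (string_measure M X) ({..X} \<inter> {..x}) = measure (string_measure M X') ({..X} \<inter> {..x})" for x
  proof -
    have i: "{..X} \<inter> {..x} = {..min X x}" by auto
    show ?thesis
      using fun_cong[OF cdf_string_measure[OF M X(1) X1], of "min X x"]
        fun_cong[OF cdf_string_measure[OF M _ X(3)], of "min X x"] X
      unfolding cdf_def i by (auto simp: stopped_cdf_def min_def)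
  qed
  show "integrable (string_measure M X) h \<longleftrightarrow> integrable (string_measure M X') h"
    by (rule integral_eq_of_measures_agree_on(1)[OF fb _ eq]) (use X h in auto)
  show "integral\<^sup>L (string_measure M X) h = integral\<^sup>L (string_measure M X') h"
    by (rule integral_eq_of_measures_agree_on(2)[OF fb _ eq]) (use X h in auto)
qed

text \<open>
  Two strings that coincide on \<open>[0,p)\<close> have the same measure there, although they may have different
  atoms at \<open>p\<close>; the total mass of \<open>[0,p)\<close> is recovered as a left limit of the distribution function.
\<close>

lemma
  assumes M: "is_string M" "is_string N"
    and X: "0 \<le> p" "p \<le> X" "p \<le> Y" "ennreal X < string_length M" "ennreal Y < string_length N"
    and eq: "\<And>x. 0 \<le> x \<Longrightarrow> x < p \<Longrightarrow> M (ennreal x) = N (ennreal x)"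
  shows string_measure_agree_open:
     "measure (string_measure M X) ({..<p} \<inter> {..x}) = measure (string_measure N Y) ({..<p} \<inter> {..x})"
    and string_integral_agree_open: "(\<And>x. x \<ge> p \<Longrightarrow> h x = (0::real)) \<Longrightarrow>
       integral\<^sup>L (string_measure M X) h = integral\<^sup>L (string_measure N Y) h"
proof -
  interpret M: finite_borel_measure "string_measure M X"
    using finite_borel_measure_string M X by auto
  interpret N: finite_borel_measure "string_measure N Y"
    using finite_borel_measure_string M X by auto
  have c: "cdf (string_measure M X) x = cdf (string_measure N Y) x" if "x < p" for x
    using that cdf_string_measure[OF M(1), of X] cdf_string_measure[OF M(2), of Y] X eq[of x]
    by (auto simp: stopped_cdf_def min_def)
  have "(cdf (string_measure M X) \<longlongrightarrow> measure (string_measure N Y) {..<p}) (at_left p)"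
    by (rule Lim_transform_eventually[OF N.cdf_at_left])
       (use c in \<open>auto simp: eventually_at_left[of "p-1"] intro!: exI[of _ "p-1"]\<close>)
  then have l: "measure (string_measure M X) {..<p} = measure (string_measure N Y) {..<p}"
    using M.cdf_at_left tendsto_unique trivial_limit_at_left_real by blast
  show eq: "measure (string_measure M X) ({..<p} \<inter> {..x}) = measure (string_measure N Y) ({..<p} \<inter> {..x})" for x
  proof (cases "x < p")
    case True
    then have "{..<p} \<inter> {..x} = {..x}" by auto
    then show ?thesis using c[OF True] by (simp add: cdf_def)
  next
    case False
    then have "{..<p} \<inter> {..x} = {..<p}" by auto
    then show ?thesis using l by simp
  qed
  show "integral\<^sup>L (string_measure M X) h = integral\<^sup>L (string_measure N Y) h" 
    if "(\<And>x. x \<ge> p \<Longrightarrow> h x = (0::real))"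
    by (rule integral_eq_of_measures_agree_on(2)[OF M.finite_borel_measure_axioms N.finite_borel_measure_axioms _ eq])
       (use that in \<open>auto simp: not_less\<close>)
qed

section \<open>Solutions of the string equation\<close>

lemma set_integrable_bounded:
  fixes g :: "real \<Rightarrow> real"
  assumes "finite_borel_measure \<mu>" "A \<in> sets borel" "set_borel_measurable borel A g"
    and "\<And>s. s \<in> A \<Longrightarrow> \<bar>g s\<bar> \<le> K"
  shows "set_integrable \<mu> A g"
proof -
  interpret finite_borel_measure \<mu> by fact
  have "(\<lambda>s. indicator A s *\<^sub>R g s) \<in> borel_measurable \<mu>"
    using assms(3) measurable_cong_sets[OF M_is_borel refl] unfolding set_borel_measurable_def by blast
  moreover have "norm (indicator A s *\<^sub>R g s) \<le> \<bar>K\<bar>" for s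
    using assms(4)[of s] by (cases "s \<in> A") auto
  ultimately show ?thesis unfolding set_integrable_def
    by (intro integrable_const_bound[where B="\<bar>K\<bar>"] AE_I2)
qed

lemma abs_set_integral_le:
  fixes g :: "real \<Rightarrow> real"
  assumes "finite_borel_measure \<mu>" "A \<in> sets borel" "set_integrable \<mu> A g"
    and "\<And>s. s \<in> A \<Longrightarrow> \<bar>g s\<bar> \<le> K"
  shows "\<bar>LINT s:A|\<mu>. g s\<bar> \<le> K * measure \<mu> A"
proof -
  interpret finite_borel_measure \<mu> by fact
  have A: "A \<in> sets \<mu>" using assms(2) by (simp add: M_is_borel)
  have c: "integrable \<mu> (\<lambda>s. indicator A s *\<^sub>R K)"
    using A by (intro integrable_scaleR_left integrable_real_indicator) (simp_all add: emeasure_eq_measure)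
  have "\<bar>LINT s:A|\<mu>. g s\<bar> \<le> (\<integral>s. \<bar>indicator A s *\<^sub>R g s\<bar> \<partial>\<mu>)"
    unfolding set_lebesgue_integral_def by (rule integral_abs_bound)
  also have "\<dots> \<le> (\<integral>s. indicator A s *\<^sub>R K \<partial>\<mu>)"
    using assms(3,4) c unfolding set_integrable_def
    by (intro integral_mono) (auto simp: indicator_def)
  also have "\<dots> = K * measure \<mu> A"
    using A by (simp add: borel_UNIV)
  finally show ?thesis .
qed

lemma set_integral_lower_bound:
  fixes g :: "real \<Rightarrow> real"
  assumes "finite_borel_measure \<mu>" "A \<in> sets borel" "set_integrable \<mu> A g"
    and "\<And>s. s \<in> A \<Longrightarrow> K \<le> g s"
  shows "K * measure \<mu> A \<le> (LINT s:A|\<mu>. g s)"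
proof -
  interpret finite_borel_measure \<mu> by fact
  have A: "A \<in> sets \<mu>" using assms(2) by (simp add: M_is_borel)
  have c: "integrable \<mu> (\<lambda>s. indicator A s *\<^sub>R K)"
    using A by (intro integrable_scaleR_left integrable_real_indicator) (simp_all add: emeasure_eq_measure)
  have "K * measure \<mu> A = (\<integral>s. indicator A s *\<^sub>R K \<partial>\<mu>)"
    using A by (simp add: borel_UNIV)
  also have "\<dots> \<le> (LINT s:A|\<mu>. g s)"
    using assms(3,4) c unfolding set_integrable_def set_lebesgue_integral_def
    by (intro integral_mono) (auto simp: indicator_def)
  finally show ?thesis .
qed

text \<open>
  The string equation on \<open>[a,c]\<close> for a function \<open>f\<close> with right derivative \<open>d\<close>, written as an evolution
  from \<open>x\<close> to \<open>y\<close> with no reference to initial values. In this form it can be restarted at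
  every point, passes to subintervals and is linear. Boundedness and measurability are included so
  that all integrals exist.
\<close>

definition string_flow ::
  "real measure \<Rightarrow> real \<Rightarrow> real \<Rightarrow> real \<Rightarrow> (real \<Rightarrow> real) \<Rightarrow> (real \<Rightarrow> real) \<Rightarrow> bool" where
  "string_flow \<mu> t a c f d \<longleftrightarrow>
     set_borel_measurable borel {a..c} f \<and> (\<exists>K. \<forall>s\<in>{a..c}. \<bar>f s\<bar> \<le> K) \<and>
     (\<forall>x y. a \<le> x \<longrightarrow> x \<le> y \<longrightarrow> y \<le> c \<longrightarrow>
        f y = f x + d x * (y - x) + t * (LINT s:{x<..y}|\<mu>. (y - s) * f s) \<and>
        d y = d x + t * (LINT s:{x<..y}|\<mu>. f s))"

lemma string_flow_eqs:
  assumes "string_flow \<mu> t a c f d" "a \<le> x" "x \<le> y" "y \<le> c"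
  shows "f y = f x + d x * (y - x) + t * (LINT s:{x<..y}|\<mu>. (y - s) * f s)"
    and "d y = d x + t * (LINT s:{x<..y}|\<mu>. f s)"
  using assms unfolding string_flow_def by blast+

lemma string_flow_bounded:
  assumes "string_flow \<mu> t a c f d"
  obtains K where "\<And>s. s \<in> {a..c} \<Longrightarrow> \<bar>f s\<bar> \<le> K"
  using assms unfolding string_flow_def by blast

lemma string_flow_measurable:
  "string_flow \<mu> t a c f d \<Longrightarrow> set_borel_measurable borel {a..c} f"
  unfolding string_flow_def by blast

lemma set_borel_measurable_Ioc:
  fixes f :: "real \<Rightarrow> real"
  assumes "set_borel_measurable borel {a..c} f" "a \<le> x" "y \<le> c" and [measurable]: "w \<in> borel_measurable borel"
  shows "set_borel_measurable borel {x<..y} (\<lambda>s. w s * f s)"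
proof -
  have [measurable]: "(\<lambda>s. indicator {a..c} s *\<^sub>R f s) \<in> borel_measurable borel"
    using assms unfolding set_borel_measurable_def by simp
  have eq: "(\<lambda>s. indicator {x<..y} s *\<^sub>R (w s * f s)) = (\<lambda>s. indicator {x<..y} s * (w s * (indicator {a..c} s *\<^sub>R f s)))"
    using assms by (auto simp: indicator_def fun_eq_iff)
  show ?thesis unfolding set_borel_measurable_def eq by measurable
qed

lemma string_flow_integrable:
  assumes "finite_borel_measure \<mu>" "string_flow \<mu> t a c f d" "a \<le> x" "y \<le> c"
  shows "set_integrable \<mu> {x<..y} f" "set_integrable \<mu> {x<..y} (\<lambda>s. (y - s) * f s)"
proof -
  note m = string_flow_measurable[OF assms(2)]
  obtain K where K: "\<And>s. s \<in> {a..c} \<Longrightarrow> \<bar>f s\<bar> \<le> K"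
    using string_flow_bounded[OF assms(2)] by blast
  have 1: "set_borel_measurable borel {x<..y} f"
    using set_borel_measurable_Ioc[OF m assms(3,4), of "\<lambda>s. 1"] by simp
  have b1: "\<bar>f s\<bar> \<le> K" if "s \<in> {x<..y}" for s
    using K[of s] that assms(3,4) by simp
  show "set_integrable \<mu> {x<..y} f"
    by (rule set_integrable_bounded[OF assms(1) _ 1 b1]) simp_all
  have 2: "set_borel_measurable borel {x<..y} (\<lambda>s. (y - s) * f s)"
    by (rule set_borel_measurable_Ioc[OF m assms(3,4), of "\<lambda>s. y - s"]) simp
  have b2: "\<bar>(y - s) * f s\<bar> \<le> (y - x) * K" if "s \<in> {x<..y}" for s
    unfolding abs_mult by (rule mult_mono) (use that b1[OF that] in auto)
  show "set_integrable \<mu> {x<..y} (\<lambda>s. (y - s) * f s)"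
    by (rule set_integrable_bounded[OF assms(1) _ 2 b2]) simp_all
qed

lemma string_flow_subinterval:
  assumes "string_flow \<mu> t a c f d" "a \<le> a'" "c' \<le> c"
  shows "string_flow \<mu> t a' c' f d"
proof -
  have m: "(\<lambda>s. indicator {a..c} s *\<^sub>R f s) \<in> borel_measurable borel"
    using string_flow_measurable[OF assms(1)] unfolding set_borel_measurable_def .
  have "(\<lambda>s. indicator {a'..c'} s *\<^sub>R (indicator {a..c} s *\<^sub>R f s)) \<in> borel_measurable borel"
    by (intro borel_measurable_scaleR m) simp
  also have "(\<lambda>s. indicator {a'..c'} s *\<^sub>R (indicator {a..c} s *\<^sub>R f s)) = (\<lambda>s. indicator {a'..c'} s *\<^sub>R f s)"
    using assms by (auto simp: indicator_def fun_eq_iff)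
  finally have "set_borel_measurable borel {a'..c'} f" unfolding set_borel_measurable_def .
  moreover obtain K where "\<And>s. s \<in> {a..c} \<Longrightarrow> \<bar>f s\<bar> \<le> K"
    using string_flow_bounded[OF assms(1)] by blast
  then have "\<exists>K. \<forall>s\<in>{a'..c'}. \<bar>f s\<bar> \<le> K" using assms(2,3) by (intro exI[of _ K]) auto
  ultimately show ?thesis
    unfolding string_flow_def using string_flow_eqs[OF assms(1)] assms(2,3) by (meson order_trans)
qed

lemma string_flow_linear:
  assumes \<mu>: "finite_borel_measure \<mu>" and f: "string_flow \<mu> t a c f d" and g: "string_flow \<mu> t a c g e"
  shows "string_flow \<mu> t a c (\<lambda>x. p * f x + q * g x) (\<lambda>x. p * d x + q * e x)"
proof -
  note m = string_flow_measurable[OF f]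
  obtain K where K: "\<And>s. s \<in> {a..c} \<Longrightarrow> \<bar>f s\<bar> \<le> K"
    using string_flow_bounded[OF f] by blast
  note m' = string_flow_measurable[OF g]
  obtain L where L: "\<And>s. s \<in> {a..c} \<Longrightarrow> \<bar>g s\<bar> \<le> L"
    using string_flow_bounded[OF g] by blast
  have "(\<lambda>x. p * (indicator {a..c} x *\<^sub>R f x) + q * (indicator {a..c} x *\<^sub>R g x)) \<in> borel_measurable borel"
    using m m' unfolding set_borel_measurable_def by measurable
  then have 1: "set_borel_measurable borel {a..c} (\<lambda>x. p * f x + q * g x)"
    unfolding set_borel_measurable_def by (simp add: algebra_simps)
  have "\<bar>p * f s + q * g s\<bar> \<le> \<bar>p\<bar> * K + \<bar>q\<bar> * L" if "s \<in> {a..c}" for s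
    using K[OF that] L[OF that] abs_triangle_ineq[of "p * f s" "q * g s"]
      mult_left_mono[of "\<bar>f s\<bar>" K "\<bar>p\<bar>"] mult_left_mono[of "\<bar>g s\<bar>" L "\<bar>q\<bar>"]
    by (simp add: abs_mult)
  then have 2: "\<exists>K. \<forall>s\<in>{a..c}. \<bar>p * f s + q * g s\<bar> \<le> K" by blast
  show ?thesis unfolding string_flow_def
  proof (intro conjI 1 2 allI impI)
    fix x y assume xy: "a \<le> x" "x \<le> y" "y \<le> c"
    note i = string_flow_integrable[OF \<mu> f xy(1,3)] string_flow_integrable[OF \<mu> g xy(1,3)]
    have "(LINT s:{x<..y}|\<mu>. (y - s) * (p * f s + q * g s))
        = (LINT s:{x<..y}|\<mu>. p * ((y - s) * f s) + q * ((y - s) * g s))"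
      by (simp add: algebra_simps)
    also have "\<dots> = p * (LINT s:{x<..y}|\<mu>. (y - s) * f s) + q * (LINT s:{x<..y}|\<mu>. (y - s) * g s)"
      using i by (subst set_integral_add) auto
    finally have A: "(LINT s:{x<..y}|\<mu>. (y - s) * (p * f s + q * g s)) = p * (LINT s:{x<..y}|\<mu>. (y - s) * f s) + q * (LINT s:{x<..y}|\<mu>. (y - s) * g s)" .
    show "p * f y + q * g y = p * f x + q * g x + (p * d x + q * e x) * (y - x) +
        t * (LINT s:{x<..y}|\<mu>. (y - s) * (p * f s + q * g s))"
      unfolding A string_flow_eqs(1)[OF f xy] string_flow_eqs(1)[OF g xy] by (simp add: algebra_simps)
    have B: "(LINT s:{x<..y}|\<mu>. (p * f s + q * g s))
      = p * (LINT s:{x<..y}|\<mu>. f s) + q * (LINT s:{x<..y}|\<mu>. g s)"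
      using i by (subst set_integral_add) auto
    show "p * d y + q * e y = p * d x + q * e x + t * (LINT s:{x<..y}|\<mu>. p * f s + q * g s)"
      unfolding B string_flow_eqs(2)[OF f xy] string_flow_eqs(2)[OF g xy] by (simp add: algebra_simps)
  qed
qed

text \<open>
  The kernel \<open>x - s\<close> of the string equation gains one power of the length in each Picard step; the
  factor \<open>1 / (n + 1)\<close> comes from maximising \<open>(h - u) u\<^sup>n\<close> and accumulates to the factorial in
  \<open>string_flow_nonneg\<close>, whatever the measure is.
\<close>

lemma power_times_gap_le:
  fixes u h :: real
  assumes "0 \<le> u" "u \<le> h"
  shows "(h - u) * u ^ n \<le> h ^ Suc n / real (Suc n)"
proof -
  have "real (Suc n) * ((h - u) * u ^ n) + u ^ Suc n \<le> h ^ Suc n" using assms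
  proof (induction n)
    case (Suc n)
    have "real (Suc (Suc n)) * ((h - u) * u ^ Suc n) + u ^ Suc (Suc n)
      = u * (real (Suc n) * ((h - u) * u ^ n) + u ^ Suc n) + (h - u) * u ^ Suc n" 
      by (simp add: algebra_simps)
    also have "\<dots> \<le> u * h ^ Suc n + (h - u) * h ^ Suc n"
      by (intro add_mono mult_left_mono power_mono) (use Suc in auto)
    finally show ?case by (simp add: algebra_simps)
  qed simp
  moreover have "0 \<le> u ^ Suc n" using assms by simp
  ultimately have "real (Suc n) * ((h - u) * u ^ n) \<le> h ^ Suc n" by linarith
  then show ?thesis by (simp add: field_simps)
qed

text \<open>
  A Gronwall argument: inserting the bound \<open>f \<ge> -K (t m (x - a))\<^sup>n / n!\<close>, with \<open>m\<close> the total mass,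
  into the equation reproduces it with \<open>n + 1\<close> in place of \<open>n\<close>.
\<close>

lemma string_flow_nonneg:
  assumes \<mu>: "finite_borel_measure \<mu>" and f: "string_flow \<mu> t a c f d" and t: "0 \<le> t"
    and init: "0 \<le> f a" "0 \<le> d a" and x: "x \<in> {a..c}"
  shows "0 \<le> f x"
proof -
  interpret finite_borel_measure \<mu> by fact
  obtain K where K: "\<And>s. s \<in> {a..c} \<Longrightarrow> \<bar>f s\<bar> \<le> K"
    using string_flow_bounded[OF f] by blast
  have K0: "0 \<le> K" using K[OF x] by simp
  define m where "m = measure \<mu> UNIV"
  have m0: "0 \<le> m" by (simp add: m_def)
  have bound: "- f x \<le> K * ((t * m * (x - a)) ^ n / fact n)" if "x \<in> {a..c}" for n x
    using that
  proof (induction n arbitrary: x)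
    case 0
    then show ?case using K[of x] by simp
  next
    case (Suc n)
    define B where "B = K * (t * m) ^ n / fact n * ((x - a) ^ Suc n / real (Suc n))"
    have B0: "0 \<le> B" using K0 m0 t Suc.prems by (simp add: B_def)
    have "- B \<le> (x - s) * f s" if s: "s \<in> {a<..x}" for s
    proof -
      have "(x - s) * (- f s) \<le> (x - s) * (K * ((t * m * (s - a)) ^ n / fact n))"
        by (intro mult_left_mono Suc.IH) (use s Suc.prems in auto)
      also have "\<dots> = K * (t * m) ^ n / fact n * ((x - a - (s - a)) * (s - a) ^ n)"
        by (simp add: power_mult_distrib)
      also have "\<dots> \<le> B" unfolding B_def
        by (intro mult_left_mono power_times_gap_le) (use s K0 t m0 in auto)
      finally show ?thesis by simp
    qed
    then have "- B * measure \<mu> {a<..x} \<le> (LINT s:{a<..x}|\<mu>. (x - s) * f s)"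
      by (intro set_integral_lower_bound[OF \<mu>] string_flow_integrable[OF \<mu> f]) (use Suc.prems in auto)
    moreover have "B * measure \<mu> {a<..x} \<le> B * m"
      unfolding m_def by (intro mult_left_mono finite_measure_mono B0) (auto simp: M_is_borel)
    ultimately have "t * (- (B * m)) \<le> t * (LINT s:{a<..x}|\<mu>. (x - s) * f s)"
      by (intro mult_left_mono t) linarith
    moreover have "f x = f a + d a * (x - a) + t * (LINT s:{a<..x}|\<mu>. (x - s) * f s)"
      by (rule string_flow_eqs(1)[OF f]) (use Suc.prems in auto)
    moreover have "0 \<le> d a * (x - a)" using init Suc.prems by simp
    moreover have "K * ((t * m * (x - a)) ^ Suc n / fact (Suc n)) = t * (B * m)"
      by (simp add: B_def power_mult_distrib mult_ac)
    ultimately show ?case using init by linarith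
  qed
  have "(\<lambda>n. K * ((t * m * (x - a)) ^ n / fact n)) \<longlonglongrightarrow> K * 0"
    by (intro tendsto_mult tendsto_const summable_LIMSEQ_zero)
      (use summable_exp_generic[of "t * m * (x - a)"] in \<open>simp add: divide_inverse mult.commute\<close>)
  then have "- f x \<le> 0"
    by (intro tendsto_lowerbound[where f="\<lambda>n. K * ((t * m * (x - a)) ^ n / fact n)"]) (use bound[OF x] in auto)
  then show ?thesis by simp
qed

text \<open>
  Uniqueness for the initial value problem, since positivity applies to both \<open>f\<close> and \<open>-f\<close>.
\<close>

lemma string_flow_zero:
  assumes \<mu>: "finite_borel_measure \<mu>" and f: "string_flow \<mu> t a c f d" and t: "0 \<le> t"
    and init: "f a = 0" "d a = 0" and x: "x \<in> {a..c}"
  shows "f x = 0"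
proof -
  have "0 \<le> f x" by (rule string_flow_nonneg[OF \<mu> f t _ _ x]) (simp_all add: init)
  moreover have "0 \<le> (-1) * f x + 0 * f x"
    by (rule string_flow_nonneg[OF \<mu> string_flow_linear[OF \<mu> f f] t _ _ x]) (simp_all add: init)
  ultimately show ?thesis by simp
qed

lemma
  assumes \<mu>: "finite_borel_measure \<mu>" and f: "string_flow \<mu> t a c f d" and t: "0 \<le> t"
    and init: "0 \<le> f a" "0 \<le> d a" and xy: "a \<le> x" "x \<le> y" "y \<le> c"
  shows string_flow_slope_nonneg: "0 \<le> d x"
    and string_flow_tangent: "f x + d x * (y - x) \<le> f y"
    and string_flow_mono: "f x \<le> f y"
proof -
  have nn: "0 \<le> f s" if "s \<in> {a..c}" for s using string_flow_nonneg[OF \<mu> f t init that] .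
  have s: "0 \<le> (LINT s:{x<..y}|\<mu>. f s)" if "a \<le> x" "y \<le> c" for x y
    using set_integral_lower_bound[OF \<mu> _ string_flow_integrable(1)[OF \<mu> f that], of 0] nn that by auto
  have s': "0 \<le> (LINT s:{x<..y}|\<mu>. (y - s) * f s)"
    using set_integral_lower_bound[OF \<mu> _ string_flow_integrable(2)[OF \<mu> f], of x y 0] nn xy by auto
  have "d x = d a + t * (LINT s:{a<..x}|\<mu>. f s)" by (rule string_flow_eqs(2)[OF f]) (use xy in auto)
  moreover have "0 \<le> t * (LINT s:{a<..x}|\<mu>. f s)" using s[of a x] t xy by simp
  ultimately show "0 \<le> d x" using init by linarith
  then have "0 \<le> d x * (y - x)" using xy by simp
  show "f x + d x * (y - x) \<le> f y" using string_flow_eqs(1)[OF f xy] s' t by simp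
  with \<open>0 \<le> d x * (y - x)\<close> show "f x \<le> f y" by linarith
qed

text \<open>
  Over \<open>n\<close> equal parts the increments of \<open>w\<close> add up to at most \<open>K (c - a) (G c - G a) / n\<close>.
\<close>

lemma constant_of_second_order_increments:
  fixes w G :: "real \<Rightarrow> real"
  assumes inc: "\<And>x y. a \<le> x \<Longrightarrow> x \<le> y \<Longrightarrow> y \<le> c \<Longrightarrow> \<bar>w y - w x\<bar> \<le> K * (y - x) * (G y - G x)"
    and "a \<le> c"
  shows "w c = w a"
proof -
  have bound: "\<bar>w c - w a\<bar> \<le> K * (c - a) * (G c - G a) / real n" if n: "n > 0" for n :: nat
  proof -
    define p where "p i = a + (c - a) * real i / real n" for i
    have p: "p 0 = a" "p n = c" using n by (auto simp: p_def)
    have step: "p (Suc i) - p i = (c - a) / real n" for i by (simp add: p_def diff_divide_distrib add_divide_distrib algebra_simps)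
    have r: "a \<le> p i" "p i \<le> c" if "i \<le> n" for i
    proof -
      show "a \<le> p i" using \<open>a \<le> c\<close> by (simp add: p_def)
      have "(c - a) * (real i / real n) \<le> (c - a) * 1" using \<open>a \<le> c\<close> that n by (intro mult_left_mono) auto
      then show "p i \<le> c" by (simp add: p_def)
    qed
    have "\<bar>w c - w a\<bar> = \<bar>\<Sum>i<n. w (p (Suc i)) - w (p i)\<bar>" by (subst sum_lessThan_telescope) (simp add: p)
    also have "\<dots> \<le> (\<Sum>i<n. \<bar>w (p (Suc i)) - w (p i)\<bar>)" by (rule sum_abs)
    also have "\<dots> \<le> (\<Sum>i<n. K * ((c - a) / real n) * (G (p (Suc i)) - G (p i)))"
    proof (rule sum_mono)
      fix i assume i: "i \<in> {..<n}"
      have "0 \<le> (c - a) / real n" using \<open>a \<le> c\<close> by simp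
      then have "p i \<le> p (Suc i)" using step[of i] by linarith
      with inc[of "p i" "p (Suc i)"] r[of i] r[of "Suc i"] i step[of i]
      show "\<bar>w (p (Suc i)) - w (p i)\<bar> \<le> K * ((c - a) / real n) * (G (p (Suc i)) - G (p i))" by simp
    qed
    also have "\<dots> = K * ((c - a) / real n) * (G c - G a)"
      using sum_lessThan_telescope[of "\<lambda>i. G (p i)" n] by (simp only: sum_distrib_left[symmetric] p)
    finally show ?thesis by simp
  qed
  have "(\<lambda>n. K * (c - a) * (G c - G a) / real n) \<longlonglongrightarrow> 0"
    by (rule lim_const_over_n)
  then have "\<bar>w c - w a\<bar> \<le> 0"
    by (rule tendsto_lowerbound) (auto intro!: eventually_sequentiallyI[of 1] bound)
  then show ?thesis by simp
qed

text \<open>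
  Between \<open>x\<close> and \<open>y\<close> the terms of first order cancel, and the Wronskian changes by at most a constant times
  \<open>(y - x) \<mu>(x,y]\<close>. This avoids an integration by parts for Stieltjes integrals.
\<close>

lemma string_flow_wronskian:
  assumes \<mu>: "finite_borel_measure \<mu>" and f: "string_flow \<mu> t a c f d" and g: "string_flow \<mu> t a c g e"
    and t: "0 \<le> t" and x: "x \<in> {a..c}"
  shows "f x * e x - d x * g x = f a * e a - d a * g a"
proof -
  interpret finite_borel_measure \<mu> by fact
  define m where "m = measure \<mu> UNIV"
  have m0: "0 \<le> m" by (simp add: m_def)
  have mle: "measure \<mu> A \<le> m" for A by (simp add: m_def bounded_measure borel_UNIV[symmetric])
  have bounds: "\<exists>K D L. (\<forall>s\<in>{a..c}. \<bar>f s\<bar> \<le> K) \<and> (\<forall>s\<in>{a..c}. \<bar>d s\<bar> \<le> D) \<and>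
      (\<forall>s y. a \<le> s \<longrightarrow> s \<le> y \<longrightarrow> y \<le> c \<longrightarrow> \<bar>f y - f s\<bar> \<le> L * (y - s)) \<and>
      (\<forall>s y. a \<le> s \<longrightarrow> s \<le> y \<longrightarrow> y \<le> c \<longrightarrow> \<bar>LINT u:{s<..y}|\<mu>. (y - u) * f u\<bar> \<le> K * (y - s) * measure \<mu> {s<..y})"
    if f: "string_flow \<mu> t a c f d" for f d
  proof -
    obtain K where K: "\<And>s. s \<in> {a..c} \<Longrightarrow> \<bar>f s\<bar> \<le> K"
      using string_flow_bounded[OF f] by blast
    have K0: "0 \<le> K" using K[OF x] by simp
    have J: "\<bar>LINT u:{s<..y}|\<mu>. (y - u) * f u\<bar> \<le> K * (y - s) * measure \<mu> {s<..y}"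
      if "a \<le> s" "s \<le> y" "y \<le> c" for s y
    proof -
      have "\<bar>(y - u) * f u\<bar> \<le> K * (y - s)" if "u \<in> {s<..y}" for u
        using mult_mono[of "y - u" "y - s" "\<bar>f u\<bar>" K] K[of u] that \<open>a \<le> s\<close> \<open>y \<le> c\<close>
        by (simp add: abs_mult mult.commute)
      then show ?thesis
        by (intro abs_set_integral_le[OF \<mu>] string_flow_integrable[OF \<mu> f]) (use that in auto)
    qed
    have I: "\<bar>LINT u:{s<..y}|\<mu>. f u\<bar> \<le> K * m" if "a \<le> s" "s \<le> y" "y \<le> c" for s y
    proof -
      have "\<bar>LINT u:{s<..y}|\<mu>. f u\<bar> \<le> K * measure \<mu> {s<..y}"
        by (intro abs_set_integral_le[OF \<mu>] string_flow_integrable[OF \<mu> f]) (use that K in auto)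
      also have "\<dots> \<le> K * m" using K0 mle by (intro mult_left_mono)
      finally show ?thesis .
    qed
    define D where "D = \<bar>d a\<bar> + t * (K * m)"
    have D: "\<bar>d s\<bar> \<le> D" if "s \<in> {a..c}" for s
    proof -
      have "t * \<bar>LINT u:{a<..s}|\<mu>. f u\<bar> \<le> t * (K * m)" using that t by (intro mult_left_mono I) auto
      moreover have "\<bar>t * (LINT u:{a<..s}|\<mu>. f u)\<bar> = t * \<bar>LINT u:{a<..s}|\<mu>. f u\<bar>" using t by (simp add: abs_mult)
      moreover have "d s = d a + t * (LINT u:{a<..s}|\<mu>. f u)" using string_flow_eqs(2)[OF f, of a s] that by simp
      ultimately show ?thesis unfolding D_def by linarith
    qed
    have "\<bar>f y - f s\<bar> \<le> (D + t * (K * m)) * (y - s)" if sy: "a \<le> s" "s \<le> y" "y \<le> c" for s y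
    proof -
      have "\<bar>f y - f s\<bar> \<le> \<bar>d s * (y - s)\<bar> + \<bar>t * (LINT u:{s<..y}|\<mu>. (y - u) * f u)\<bar>"
        using string_flow_eqs(1)[OF f sy] by linarith
      also have "\<bar>d s * (y - s)\<bar> \<le> D * (y - s)" using D[of s] sy by (simp add: abs_mult mult_right_mono)
      also have "\<bar>t * (LINT u:{s<..y}|\<mu>. (y - u) * f u)\<bar> \<le> t * (K * (y - s) * measure \<mu> {s<..y})"
        using t J[OF sy] by (simp add: abs_mult mult_left_mono)
      also have "\<dots> \<le> t * (K * (y - s) * m)" using t K0 sy mle by (intro mult_left_mono) auto
      finally show ?thesis by (simp add: algebra_simps)
    qed
    with K D J show ?thesis by (intro exI[of _ K] exI[of _ D] exI[of _ "D + t * (K * m)"]) auto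
  qed
  obtain K D L where K: "\<And>s. s \<in> {a..c} \<Longrightarrow> \<bar>f s\<bar> \<le> K" and D: "\<And>s. s \<in> {a..c} \<Longrightarrow> \<bar>d s\<bar> \<le> D"
     and L: "\<And>s y. a \<le> s \<Longrightarrow> s \<le> y \<Longrightarrow> y \<le> c \<Longrightarrow> \<bar>f y - f s\<bar> \<le> L * (y - s)"
     and J: "\<And>s y. a \<le> s \<Longrightarrow> s \<le> y \<Longrightarrow> y \<le> c \<Longrightarrow> \<bar>LINT u:{s<..y}|\<mu>. (y - u) * f u\<bar> \<le> K * (y - s) * measure \<mu> {s<..y}"
    using bounds[OF f] by blast
  obtain K' D' L' where K': "\<And>s. s \<in> {a..c} \<Longrightarrow> \<bar>g s\<bar> \<le> K'" and D': "\<And>s. s \<in> {a..c} \<Longrightarrow> \<bar>e s\<bar> \<le> D'"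
     and L': "\<And>s y. a \<le> s \<Longrightarrow> s \<le> y \<Longrightarrow> y \<le> c \<Longrightarrow> \<bar>g y - g s\<bar> \<le> L' * (y - s)"
     and J': "\<And>s y. a \<le> s \<Longrightarrow> s \<le> y \<Longrightarrow> y \<le> c \<Longrightarrow> \<bar>LINT u:{s<..y}|\<mu>. (y - u) * g u\<bar> \<le> K' * (y - s) * measure \<mu> {s<..y}"
    using bounds[OF g] by blast
  define C where "C = t * (K * D' + K' * D + (L * K' + L' * K))"
  define w where "w s = f s * e s - d s * g s" for s
  have main: "\<bar>w y - w s\<bar> \<le> C * (y - s) * (cdf \<mu> y - cdf \<mu> s)" if sy: "a \<le> s" "s \<le> y" "y \<le> x" for s y
  proof (cases "s = y")
    case False
    have yc: "y \<le> c" using sy x by simp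
    let ?m = "measure \<mu> {s<..y}"
    let ?J = "LINT u:{s<..y}|\<mu>. (y - u) * f u" and ?J' = "LINT u:{s<..y}|\<mu>. (y - u) * g u"
    let ?I = "LINT u:{s<..y}|\<mu>. f u" and ?I' = "LINT u:{s<..y}|\<mu>. g u"
    note inf = string_flow_integrable[OF \<mu> f sy(1) yc] and ing = string_flow_integrable[OF \<mu> g sy(1) yc]
    have E: "w y - w s = t * ?J * e s - t * ?J' * d s + t * (f y * ?I' - g y * ?I)"
    proof -
      have "w y - w s = (f y - f s) * e s - (g y - g s) * d s + t * (f y * ?I' - g y * ?I)"
        unfolding w_def string_flow_eqs(2)[OF f sy(1,2) yc] string_flow_eqs(2)[OF g sy(1,2) yc]
        by (simp add: algebra_simps)
      moreover have "f y - f s = d s * (y - s) + t * ?J" "g y - g s = e s * (y - s) + t * ?J'"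
        using string_flow_eqs(1)[OF f sy(1,2) yc] string_flow_eqs(1)[OF g sy(1,2) yc] by simp_all
      ultimately show ?thesis by (simp add: algebra_simps)
    qed
    have H: "f y * ?I' - g y * ?I = (LINT u:{s<..y}|\<mu>. f y * g u - g y * f u)"
      using inf ing by (subst set_integral_diff) auto
    have "\<bar>f y * g u - g y * f u\<bar> \<le> (L * K' + L' * K) * (y - s)" if u: "u \<in> {s<..y}" for u
    proof -
      have "f y * g u - g y * f u = (f y - f u) * g u - (g y - g u) * f u" by (simp add: algebra_simps)
      also have "\<bar>\<dots>\<bar> \<le> \<bar>f y - f u\<bar> * \<bar>g u\<bar> + \<bar>g y - g u\<bar> * \<bar>f u\<bar>"
        by (metis abs_mult abs_triangle_ineq4)
      also have "\<dots> \<le> (L * (y - u)) * K' + (L' * (y - u)) * K"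
      proof -
        have b: "\<bar>f y - f u\<bar> \<le> L * (y - u)" "\<bar>g y - g u\<bar> \<le> L' * (y - u)" "\<bar>g u\<bar> \<le> K'" "\<bar>f u\<bar> \<le> K"
          using L[of u y] L'[of u y] K[of u] K'[of u] u sy yc by auto
        show ?thesis
          by (intro add_mono mult_mono b) (use b abs_ge_zero order_trans in blast)+
      qed
      also have "\<dots> = (L * K' + L' * K) * (y - u)" by (simp add: algebra_simps)
      also have "\<dots> \<le> (L * K' + L' * K) * (y - s)"
      proof (rule mult_left_mono)
        have "0 \<le> L * (y - s)" "0 \<le> L' * (y - s)" using L[of s y] L'[of s y] sy yc by linarith+
        then have "0 \<le> L" "0 \<le> L'" using False sy by (auto simp: zero_le_mult_iff)
        moreover have "0 \<le> K" "0 \<le> K'" using K[OF x] K'[OF x] by auto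
        ultimately show "0 \<le> L * K' + L' * K" by simp
      qed (use u in auto)
      finally show ?thesis .
    qed
    then have "\<bar>f y * ?I' - g y * ?I\<bar> \<le> (L * K' + L' * K) * (y - s) * ?m" unfolding H
      by (intro abs_set_integral_le[OF \<mu>] set_integral_diff set_integrable_mult_right) (use inf ing in auto)
    then have 1: "\<bar>t * (f y * ?I' - g y * ?I)\<bar> \<le> t * ((L * K' + L' * K) * (y - s) * ?m)"
      using t by (simp add: abs_mult mult_left_mono)
    have 2: "\<bar>t * ?J * e s\<bar> \<le> t * (K * (y - s) * ?m) * D'"
      unfolding abs_mult using t J[of s y] D'[of s] sy yc x K[OF x]
      by (intro mult_mono) auto
    have 3: "\<bar>t * ?J' * d s\<bar> \<le> t * (K' * (y - s) * ?m) * D"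
      unfolding abs_mult using t J'[of s y] D[of s] sy yc x K'[OF x]
      by (intro mult_mono) auto
    have "\<bar>w y - w s\<bar> \<le> t * (K * (y - s) * ?m) * D' + t * (K' * (y - s) * ?m) * D + t * ((L * K' + L' * K) * (y - s) * ?m)"
    proof -
      have tri: "\<bar>A - B + C\<bar> \<le> A' + B' + C'" if "\<bar>C\<bar> \<le> C'" "\<bar>A\<bar> \<le> A'" "\<bar>B\<bar> \<le> B'" for A B C A' B' C' :: real
        using that by linarith
      show ?thesis unfolding E by (rule tri[OF 1 2 3])
    qed
    also have "\<dots> = C * (y - s) * ?m" unfolding C_def by (simp only: distrib_left distrib_right mult_ac)
    also have "?m = cdf \<mu> y - cdf \<mu> s" using cdf_diff_eq[of s y] sy False by simp
    finally show ?thesis .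
  qed simp
  have "w x = w a"
    by (rule constant_of_second_order_increments[OF main]) (use x in auto)
  then show ?thesis by (simp add: w_def)
qed

section \<open>Fundamental solutions and bounds for the characteristic function\<close>

text \<open>
  The right derivative at \<open>x\<close>, which includes the effect of an atom at \<open>x\<close>.
\<close>

definition string_slope ::
  "(ennreal \<Rightarrow> ennreal) \<Rightarrow> real \<Rightarrow> real \<Rightarrow> (real \<Rightarrow> real) \<Rightarrow> real \<Rightarrow> real" where
  "string_slope M b t f x = b + t * (LINT s:{0..x}|string_measure M x. f s)"

text \<open>
  The point \<open>X' > X\<close> is needed because the integrability of \<open>(x - s) f(s)\<close> on \<open>[0,x]\<close> says nothing about an atom
  at \<open>x\<close>; dividing by \<open>X' - s \<ge> X' - X\<close> makes \<open>f\<close> itself integrable on \<open>[0,X]\<close>.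
\<close>

lemma string_solution_flow:
  assumes M: "is_string M" and sol: "string_solution M a b (- t) f" and t: "0 \<le> t"
    and X: "0 \<le> X" "X < X'" "ennreal X' < string_length M"
  shows "string_flow (string_measure M X') t 0 X f (string_slope M b t f)"
proof -
  define \<mu> where "\<mu> = string_measure M X'"
  have \<mu>: "finite_borel_measure \<mu>" unfolding \<mu>_def using finite_borel_measure_string[OF M] X by simp
  interpret finite_borel_measure \<mu> by fact
  have below: "ennreal x < string_length M" if "x \<le> X'" for x
    using that X(3) by (meson ennreal_leI le_less_trans)
  have int': "integrable \<mu> (\<lambda>s. indicator {0..X'} s *\<^sub>R ((X' - s) * f s))"
    using sol X unfolding string_solution_def set_integrable_def \<mu>_def by auto
  define g where "g = (\<lambda>s. indicator {0..X} s *\<^sub>R f s)"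
  have g_eq: "g = (\<lambda>s. indicator {0..X} s / (X' - s) * (indicator {0..X'} s *\<^sub>R ((X' - s) * f s)))"
    using X by (auto simp: g_def indicator_def fun_eq_iff)
  have m: "(\<lambda>s. indicator {0..X'} s *\<^sub>R ((X' - s) * f s)) \<in> borel_measurable borel"
    using borel_measurable_integrable[OF int'] measurable_cong_sets[OF M_is_borel refl] by blast
  have gm: "g \<in> borel_measurable borel"
    unfolding g_eq by (intro borel_measurable_times m borel_measurable_divide) simp_all
  have gm': "g \<in> borel_measurable \<mu>"
    using gm measurable_cong_sets[OF M_is_borel refl] by blast
  have gi: "integrable \<mu> g"
  proof (rule Bochner_Integration.integrable_bound[OF integrable_divide[OF int', of "X' - X"] gm'])
    have "norm (g s) \<le> norm (indicator {0..X'} s *\<^sub>R ((X' - s) * f s) / (X' - X))" for s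
    proof (cases "s \<in> {0..X}")
      case True
      have "\<bar>f s\<bar> * (X' - X) \<le> \<bar>f s\<bar> * (X' - s)" using True X by (intro mult_left_mono) auto
      then show ?thesis using True X by (simp add: g_def abs_mult field_simps)
    qed (simp add: g_def)
    then show "AE s in \<mu>. norm (g s) \<le> norm (indicator {0..X'} s *\<^sub>R ((X' - s) * f s) / (X' - X))"
      by simp
  qed
  have f_int: "set_integrable \<mu> {0..X} f" using gi by (simp add: set_integrable_def g_def)
  have f_int_sub: "set_integrable \<mu> A f" if "A \<subseteq> {0..X}" "A \<in> sets borel" for A
    by (rule set_integrable_subset[OF f_int]) (use that in \<open>auto simp: M_is_borel\<close>)
  have wf_int: "set_integrable \<mu> A (\<lambda>s. (y - s) * f s)" if "A \<subseteq> {0..X}" "A \<in> sets borel" "y \<in> {0..X}" for A y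
  proof (rule set_integrable_bound[OF set_integrable_mult_right[OF f_int_sub[OF that(1,2)], of X]])
    have eq: "(\<lambda>s. indicator A s *\<^sub>R ((y - s) * f s)) = (\<lambda>s. indicator A s * ((y - s) * g s))"
      using that by (auto simp: g_def indicator_def fun_eq_iff)
    have "(\<lambda>s. indicator A s * ((y - s) * g s)) \<in> borel_measurable borel"
      using gm that by (intro borel_measurable_times borel_measurable_indicator) simp_all
    then show "set_borel_measurable \<mu> A (\<lambda>s. (y - s) * f s)"
      unfolding set_borel_measurable_def eq using measurable_cong_sets[OF M_is_borel refl] by blast
    have "norm ((y - s) * f s) \<le> norm (X * f s)" if "s \<in> A" for s
      unfolding norm_mult using subsetD[OF \<open>A \<subseteq> {0..X}\<close> that] \<open>y \<in> {0..X}\<close> by (intro mult_right_mono) auto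
    then show "AE s in \<mu>. s \<in> A \<longrightarrow> norm ((y - s) * f s) \<le> norm (X * f s)" by simp
  qed
  have agree: "(LINT s:{0..x}|string_measure M x. h s) = (LINT s:{0..x}|\<mu>. h s)" if "x \<in> {0..X}" for x and h :: "real \<Rightarrow> real"
    unfolding set_lebesgue_integral_def \<mu>_def
    by (rule string_integral_agree_closed(2)[OF M _ _ X(3)]) (use that X in auto)
  have f_eq: "f x = a + b * x + t * (LINT s:{0..x}|\<mu>. (x - s) * f s)" if "x \<in> {0..X}" for x
  proof -
    have "f x = a + b * x - (- t) * (LINT s:{0..x}|string_measure M x. (x - s) * f s)"
      using sol that X below[of x] unfolding string_solution_def by auto
    then show ?thesis using agree[OF that] by simp
  qed
  have d_eq: "string_slope M b t f x = b + t * (LINT s:{0..x}|\<mu>. f s)" if "x \<in> {0..X}" for x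
    unfolding string_slope_def agree[OF that] ..
  define I where "I = (LINT s:{0..X}|\<mu>. \<bar>f s\<bar>)"
  have bound: "\<bar>f x\<bar> \<le> \<bar>a\<bar> + \<bar>b\<bar> * X + t * (X * I)" if x: "x \<in> {0..X}" for x
  proof -
    have "\<bar>LINT s:{0..x}|\<mu>. (x - s) * f s\<bar> \<le> (\<integral>s. \<bar>indicator {0..x} s *\<^sub>R ((x - s) * f s)\<bar> \<partial>\<mu>)"
      unfolding set_lebesgue_integral_def by (rule integral_abs_bound)
    also have "\<dots> \<le> (\<integral>s. X * (indicator {0..X} s *\<^sub>R \<bar>f s\<bar>) \<partial>\<mu>)"
    proof (rule integral_mono)
      show "integrable \<mu> (\<lambda>s. \<bar>indicator {0..x} s *\<^sub>R ((x - s) * f s)\<bar>)"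
        using wf_int[of "{0..x}" x] x unfolding set_integrable_def by (intro integrable_abs) auto
      show "integrable \<mu> (\<lambda>s. X * (indicator {0..X} s *\<^sub>R \<bar>f s\<bar>))"
        using set_integrable_abs[OF f_int] unfolding set_integrable_def by (intro integrable_mult_right)
      show "\<bar>indicator {0..x} s *\<^sub>R ((x - s) * f s)\<bar> \<le> X * (indicator {0..X} s *\<^sub>R \<bar>f s\<bar>)" for s
        using x by (auto simp: indicator_def abs_mult intro!: mult_right_mono)
    qed
    also have "\<dots> = X * I" unfolding I_def set_lebesgue_integral_def by simp
    finally have "t * \<bar>LINT s:{0..x}|\<mu>. (x - s) * f s\<bar> \<le> t * (X * I)" using t by (rule mult_left_mono)
    moreover have "\<bar>b * x\<bar> \<le> \<bar>b\<bar> * X" using x by (simp add: abs_mult mult_left_mono)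
    moreover have "\<bar>t * (LINT s:{0..x}|\<mu>. (x - s) * f s)\<bar> = t * \<bar>LINT s:{0..x}|\<mu>. (x - s) * f s\<bar>"
      using t by (simp add: abs_mult)
    ultimately show ?thesis using f_eq[OF x] by linarith
  qed
  show ?thesis unfolding string_flow_def \<mu>_def[symmetric]
  proof (intro conjI allI impI)
    show "set_borel_measurable borel {0..X} f" using gm by (simp add: set_borel_measurable_def g_def)
    show "\<exists>K. \<forall>s\<in>{0..X}. \<bar>f s\<bar> \<le> K" using bound by blast
    fix x y assume xy: "0 \<le> x" "x \<le> y" "y \<le> X"
    have un: "{0..y} = {0..x} \<union> {x<..y}" using xy by auto
    have split: "(LINT s:{0..y}|\<mu>. h s) = (LINT s:{0..x}|\<mu>. h s) + (LINT s:{x<..y}|\<mu>. h s)"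
      if "set_integrable \<mu> {0..y} h" for h :: "real \<Rightarrow> real"
      unfolding un by (rule set_integral_Un)
        (use xy in \<open>auto intro!: set_integrable_subset[OF that] simp: M_is_borel\<close>)
    have fy: "set_integrable \<mu> {0..y} f" using xy by (intro f_int_sub) auto
    have fx: "set_integrable \<mu> {0..x} f" using xy by (intro f_int_sub) auto
    have wy: "set_integrable \<mu> {0..y} (\<lambda>s. (y - s) * f s)" using xy by (intro wf_int) auto
    have wx: "set_integrable \<mu> {0..x} (\<lambda>s. (x - s) * f s)" using xy by (intro wf_int) auto
    have "(LINT s:{0..x}|\<mu>. (y - s) * f s) = (LINT s:{0..x}|\<mu>. (x - s) * f s + (y - x) * f s)"
      by (simp add: algebra_simps)
    also have "\<dots> = (LINT s:{0..x}|\<mu>. (x - s) * f s) + (y - x) * (LINT s:{0..x}|\<mu>. f s)"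
      using wx fx by (subst set_integral_add) auto
    finally have s: "(LINT s:{0..x}|\<mu>. (y - s) * f s) = (LINT s:{0..x}|\<mu>. (x - s) * f s) + (y - x) * (LINT s:{0..x}|\<mu>. f s)" .
    have x': "x \<in> {0..X}" "y \<in> {0..X}" using xy by auto
    show "string_slope M b t f y = string_slope M b t f x + t * (LINT s:{x<..y}|\<mu>. f s)"
      unfolding d_eq[OF x'(1)] d_eq[OF x'(2)] split[OF fy] by (simp add: algebra_simps)
    show "f y = f x + string_slope M b t f x * (y - x) + t * (LINT s:{x<..y}|\<mu>. (y - s) * f s)"
      unfolding d_eq[OF x'(1)] f_eq[OF x'(2)] f_eq[OF x'(1)] split[OF wy] s by (simp only: distrib_left distrib_right right_diff_distrib mult_ac)
  qed
qed

lemma string_solution_initial: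
  assumes "string_solution M a b (- t) f" "0 < string_length M"
  shows "f 0 = a"
    and "string_slope M b t f 0 = b + t * (a * measure (string_measure M 0) {0})"
proof -
  have i: "indicat_real {0} s * (s * f s) = 0" for s :: real by (auto simp: indicator_def)
  show f0: "f 0 = a"
    using assms unfolding string_solution_def set_lebesgue_integral_def by (auto simp: i)
  have "(LINT s:{0..0}|string_measure M 0. f s) = (\<integral>s. a * indicator {0} s \<partial>string_measure M 0)"
    unfolding set_lebesgue_integral_def using f0
    by (intro arg_cong[where f="integral\<^sup>L (string_measure M 0)"]) (auto simp: indicator_def fun_eq_iff)
  also have "\<dots> = a * measure (string_measure M 0) {0}"
    by (simp add: string_measure_def)
  finally show "string_slope M b t f 0 = b + t * (a * measure (string_measure M 0) {0})"
    by (simp add: string_slope_def)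
qed

lemma real_strictly_between:
  assumes "ennreal x < L" "0 \<le> x"
  obtains y where "x < y" "ennreal y < L"
proof -
  obtain r where r: "ennreal x < r" "r < L" using dense assms(1) by blast
  then have "r < \<top>" using less_le_trans top_greatest by metis
  then have e: "ennreal (enn2real r) = r" by simp
  have "x < enn2real r" using r(1) ennreal_less_iff[OF assms(2), of "enn2real r"] unfolding e by simp
  then show thesis using that[of "enn2real r"] r(2) unfolding e by simp
qed

locale fundamental_solutions =
  fixes M :: "ennreal \<Rightarrow> ennreal" and t :: real and \<phi> \<psi> :: "real \<Rightarrow> real"
  assumes string: "is_string M" and t_pos: "0 < t"
    and \<phi>: "string_solution M 1 0 (- t) \<phi>" and \<psi>: "string_solution M 0 1 (- t) \<psi>"
begin

abbreviation "\<phi>' \<equiv> string_slope M 0 t \<phi>"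
abbreviation "\<psi>' \<equiv> string_slope M 1 t \<psi>"

lemma flows:
  assumes "0 \<le> X" "X < X'" "ennreal X' < string_length M"
  shows "finite_borel_measure (string_measure M X')"
    and "string_flow (string_measure M X') t 0 X \<phi> \<phi>'"
    and "string_flow (string_measure M X') t 0 X \<psi> \<psi>'"
  using string_solution_flow[OF string \<phi> _ assms] string_solution_flow[OF string \<psi> _ assms] t_pos
    finite_borel_measure_string[OF string _ assms(3)] assms
  by auto

lemma initial_values:
  assumes "0 < string_length M"
  shows "\<phi> 0 = 1" "0 \<le> \<phi>' 0" "\<psi> 0 = 0" "\<psi>' 0 = 1"
  using string_solution_initial[OF \<phi> assms] string_solution_initial[OF \<psi> assms] t_pos
  by auto

text \<open>
  By \<open>ratio_increasing\<close> and \<open>ratio_below_slope_ratio\<close>, \<open>\<psi>/\<phi>\<close> increases and stays below \<open>\<psi>'/\<phi>'\<close>.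
  With \<open>x\<close> fixed, each of them concerns a
  combination of \<open>\<phi>\<close> and \<open>\<psi>\<close> in the variable \<open>y\<close>; by the Wronskian its value and slope at \<open>x\<close>
  are \<open>0\<close> and \<open>1\<close> in the first case, \<open>1\<close> and \<open>0\<close> in the second, so positivity propagates to \<open>y\<close>.
\<close>

lemma
  assumes "0 \<le> x" "x \<le> y" "ennreal y < string_length M"
  shows \<phi>_ge_1: "1 \<le> \<phi> x" and \<phi>'_nonneg: "0 \<le> \<phi>' x" and \<psi>_ge: "x \<le> \<psi> x"
    and wronskian: "\<phi> x * \<psi>' x - \<phi>' x * \<psi> x = 1"
    and ratio_increasing: "y - x \<le> \<phi> x * \<psi> y - \<psi> x * \<phi> y"
    and ratio_below_slope_ratio: "1 \<le> \<phi> y * \<psi>' x - \<psi> y * \<phi>' x"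
    and \<phi>_mono: "\<phi> x \<le> \<phi> y"
proof -
  have L0: "0 < string_length M" using assms(3) by (metis gr_zeroI not_less_zero)
  obtain X' where X': "y < X'" "ennreal X' < string_length M"
    using real_strictly_between[OF assms(3)] assms(1,2) by auto
  note fl = flows[OF _ X'] and init = initial_values[OF L0]
  define \<mu> where "\<mu> = string_measure M X'"
  have \<mu>: "finite_borel_measure \<mu>" and f: "string_flow \<mu> t 0 y \<phi> \<phi>'" and g: "string_flow \<mu> t 0 y \<psi> \<psi>'"
    using fl assms unfolding \<mu>_def by auto
  have t: "0 \<le> t" using t_pos by simp
  have i\<phi>: "0 \<le> \<phi> 0" "0 \<le> \<phi>' 0" and i\<psi>: "0 \<le> \<psi> 0" "0 \<le> \<psi>' 0" using init by simp_all
  show "1 \<le> \<phi> x" using string_flow_mono[OF \<mu> f t i\<phi>, of 0 x] init assms by simp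
  show "\<phi> x \<le> \<phi> y" using string_flow_mono[OF \<mu> f t i\<phi>, of x y] assms by simp
  show "0 \<le> \<phi>' x" using string_flow_slope_nonneg[OF \<mu> f t i\<phi>, of x x] assms by simp
  show "x \<le> \<psi> x" using string_flow_tangent[OF \<mu> g t i\<psi>, of 0 x] init assms by simp
  show W: "\<phi> x * \<psi>' x - \<phi>' x * \<psi> x = 1"
    using string_flow_wronskian[OF \<mu> f g t, of x] init assms by simp
  have fx: "string_flow \<mu> t x y \<phi> \<phi>'" and gx: "string_flow \<mu> t x y \<psi> \<psi>'"
    using string_flow_subinterval[OF f, of x y] string_flow_subinterval[OF g, of x y] assms by auto
  have k: "string_flow \<mu> t x y (\<lambda>s. \<phi> x * \<psi> s + (- \<psi> x) * \<phi> s) (\<lambda>s. \<phi> x * \<psi>' s + (- \<psi> x) * \<phi>' s)"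
    by (rule string_flow_linear[OF \<mu> gx fx])
  show "y - x \<le> \<phi> x * \<psi> y - \<psi> x * \<phi> y"
    using string_flow_tangent[OF \<mu> k t _ _ order.refl assms(2) order.refl] W by (simp add: algebra_simps)
  have k: "string_flow \<mu> t x y (\<lambda>s. \<psi>' x * \<phi> s + (- \<phi>' x) * \<psi> s) (\<lambda>s. \<psi>' x * \<phi>' s + (- \<phi>' x) * \<psi>' s)"
    by (rule string_flow_linear[OF \<mu> fx gx])
  show "1 \<le> \<phi> y * \<psi>' x - \<psi> y * \<phi>' x"
    using string_flow_tangent[OF \<mu> k t _ _ order.refl assms(2) order.refl] W by (simp add: algebra_simps)
qed

end

text \<open>
  Translates the limit at the extended length of the string into statements about real points.
\<close>

lemma eventually_at_left_ennreal_between: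
  fixes L :: ennreal
  assumes "ennreal x < L" "0 \<le> x"
  shows "eventually (\<lambda>y. x \<le> enn2real y \<and> ennreal (enn2real y) = y \<and> y < L) (at_left L)"
proof -
  have "eventually (\<lambda>y. ennreal x < y) (at_left L)" "eventually (\<lambda>y. y < L) (at_left L)"
    using assms(1) by (auto simp: eventually_at_left[OF assms(1)])
  then show ?thesis
  proof eventually_elim
    case (elim y)
    then have "y < \<top>" using less_le_trans top_greatest by metis
    then have e: "ennreal (enn2real y) = y" by simp
    with elim assms(2) have "x < enn2real y" by (metis ennreal_less_iff)
    with e elim show ?case by simp
  qed
qed

lemma at_left_ennreal_nontrivial: "(0::ennreal) < L \<Longrightarrow> at_left L \<noteq> bot"
  using dense[of _ L] by (auto simp: trivial_limit_def eventually_at_left)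

text \<open>
  The limit defining \<open>W\<close> is that of an increasing function, hence bounded below by its values; for
  fixed \<open>x\<close> all later values are at most \<open>\<psi>'/\<phi>'\<close> at \<open>x\<close>, and so is the limit.
\<close>

lemma characteristic_function_bounds:
  assumes M: "is_string M" and W: "has_characteristic_function M W" and t: "0 < t" and L: "0 < string_length M"
  obtains \<phi> \<psi> where "fundamental_solutions M t \<phi> \<psi>"
    "((\<lambda>x. \<psi> (enn2real x) / \<phi> (enn2real x)) \<longlongrightarrow> Re (W (complex_of_real (- t)))) (at_left (string_length M))"
    "\<And>x. 0 \<le> x \<Longrightarrow> ennreal x < string_length M \<Longrightarrow> \<psi> x \<le> Re (W (complex_of_real (- t))) * \<phi> x"
    "\<And>x. 0 \<le> x \<Longrightarrow> ennreal x < string_length M \<Longrightarrow>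
       Re (W (complex_of_real (- t))) * string_slope M 0 t \<phi> x \<le> string_slope M 1 t \<psi> x"
proof -
  define w where "w = Re (W (complex_of_real (- t)))"
  obtain \<phi> \<psi> where s: "string_solution M 1 0 (- t) \<phi>" "string_solution M 0 1 (- t) \<psi>"
    and lim: "((\<lambda>x. complex_of_real (\<psi> (enn2real x) / \<phi> (enn2real x))) \<longlongrightarrow> W (complex_of_real (- t))) (at_left (string_length M))"
    using W t L unfolding has_characteristic_function_def by (metis neg_less_0_iff_less less_irrefl)
  interpret fundamental_solutions M t \<phi> \<psi>
    by unfold_locales (use M t s in auto)
  have lim': "((\<lambda>x. \<psi> (enn2real x) / \<phi> (enn2real x)) \<longlongrightarrow> w) (at_left (string_length M))"
    using tendsto_Re[OF lim] by (simp add: w_def)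
  note nb = at_left_ennreal_nontrivial[OF L]
  have 1: "\<psi> x \<le> w * \<phi> x" if x: "0 \<le> x" "ennreal x < string_length M" for x
  proof -
    have "eventually (\<lambda>y. \<psi> x / \<phi> x \<le> \<psi> (enn2real y) / \<phi> (enn2real y)) (at_left (string_length M))"
      using eventually_at_left_ennreal_between[OF x(2,1)]
    proof eventually_elim
      case (elim y)
      then have "0 < \<phi> x" "0 < \<phi> (enn2real y)" "\<psi> x * \<phi> (enn2real y) \<le> \<phi> x * \<psi> (enn2real y)"
        using \<phi>_ge_1[of x "enn2real y"] \<phi>_mono[of x "enn2real y"] ratio_increasing[of x "enn2real y"] x by auto
      then show ?case by (simp add: field_simps)
    qed
    from tendsto_lowerbound[OF lim' this nb] show ?thesis
      using \<phi>_ge_1[of x x] x by (simp add: field_simps)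
  qed
  have 2: "w * string_slope M 0 t \<phi> x \<le> string_slope M 1 t \<psi> x" if x: "0 \<le> x" "ennreal x < string_length M" for x
  proof -
    have "eventually (\<lambda>y. \<psi> (enn2real y) / \<phi> (enn2real y) * string_slope M 0 t \<phi> x \<le> string_slope M 1 t \<psi> x) (at_left (string_length M))"
      using eventually_at_left_ennreal_between[OF x(2,1)]
    proof eventually_elim
      case (elim y)
      then have "0 < \<phi> (enn2real y)" 
        using \<phi>_ge_1[of x "enn2real y"] \<phi>_mono[of x "enn2real y"] x by auto
      moreover have "\<psi> (enn2real y) * string_slope M 0 t \<phi> x \<le> \<phi> (enn2real y) * string_slope M 1 t \<psi> x"
        using ratio_below_slope_ratio[of x "enn2real y"] x elim by auto
      ultimately show ?case by (simp add: field_simps)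
    qed
    from tendsto_upperbound[OF tendsto_mult_right[OF lim'] this nb] show ?thesis .
  qed
  show thesis
    using that[of \<phi> \<psi>] lim' 1 2 fundamental_solutions_axioms unfolding w_def fundamental_solutions_def by blast
qed

section \<open>Comparing two strings\<close>

lemma string_measure_Ioc:
  assumes "is_string M" "0 \<le> p" "p \<le> x" "x \<le> X" "ennreal X < string_length M"
  shows "measure (string_measure M X) {p<..x} = enn2real (M (ennreal x)) - enn2real (M (ennreal p))"
proof (cases "p = x")
  case False
  have X: "0 \<le> X" using assms by simp
  interpret finite_borel_measure "string_measure M X"
    by (rule finite_borel_measure_string[OF assms(1) X assms(5)])
  have "measure (string_measure M X) {p<..x} = stopped_cdf M X x - stopped_cdf M X p"
    using cdf_diff_eq[of p x] False assms cdf_string_measure[OF assms(1) X assms(5)] by simp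
  then show ?thesis using assms by (simp add: stopped_cdf_def min_def)
qed simp

text \<open>
  The equation up to \<open>p\<close> does not see the masses at \<open>p\<close>, as the kernel vanishes there; only the slope
  does, through the difference of the two atoms.
\<close>

lemma solutions_agree:
  assumes M: "is_string M" and N: "is_string N" and t: "0 \<le> t"
    and p: "0 \<le> p" "ennreal p < string_length M" "ennreal p < string_length N"
    and eq: "\<And>x. 0 \<le> x \<Longrightarrow> x < p \<Longrightarrow> M (ennreal x) = N (ennreal x)"
    and f: "string_solution M a b (- t) f" and g: "string_solution N a b (- t) g"
  shows "\<And>x. x \<in> {0..p} \<Longrightarrow> f x = g x"
    and "string_slope N b t g p = string_slope M b t f p
       + t * (enn2real (N (ennreal p)) - enn2real (M (ennreal p))) * f p"
proof -
  obtain X where X: "p < X" "ennreal X < string_length M" using real_strictly_between[OF p(2,1)] by blast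
  obtain Y where Y: "p < Y" "ennreal Y < string_length N" using real_strictly_between[OF p(3,1)] by blast
  have L: "0 < string_length M" "0 < string_length N" using le_less_trans[OF zero_le p(2)] le_less_trans[OF zero_le p(3)] .
  have \<mu>: "finite_borel_measure (string_measure M X)" using finite_borel_measure_string[OF M] X p by simp
  have ff: "string_flow (string_measure M X) t 0 p f (string_slope M b t f)"
    by (rule string_solution_flow[OF M f t p(1) X])
  have gg: "string_flow (string_measure N Y) t 0 p g (string_slope N b t g)"
    by (rule string_solution_flow[OF N g t p(1) Y])
  have agree: "(LINT s:A|string_measure M X'. h s) = (LINT s:A|string_measure N Y'. h s)"
    if "\<And>s. s \<in> A \<Longrightarrow> p \<le> s \<Longrightarrow> h s = 0" "p \<le> X'" "p \<le> Y'" "ennreal X' < string_length M" "ennreal Y' < string_length N"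
    for A and h :: "real \<Rightarrow> real" and X' Y' :: real
    unfolding set_lebesgue_integral_def
    by (rule string_integral_agree_open[OF M N p(1)]) (use that eq in \<open>auto simp: indicator_def\<close>)
  have left: "f x = g x" if x: "0 \<le> x" "x < p" for x
  proof -
    have "string_flow (string_measure M X) t 0 x g (string_slope N b t g)"
    proof -
      have gx: "string_flow (string_measure N Y) t 0 x g (string_slope N b t g)"
        using string_flow_subinterval[OF gg] x by simp
      have i: "(LINT s:{u<..v}|string_measure N Y. h s) = (LINT s:{u<..v}|string_measure M X. h s)" if "v \<le> x" for u v and h :: "real \<Rightarrow> real"
      proof (rule agree[symmetric, OF _ less_imp_le[OF X(1)] less_imp_le[OF Y(1)] X(2) Y(2)])
        fix s assume "s \<in> {u<..v}" "p \<le> s"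
        then show "h s = 0" using that x(2) by simp
      qed
      have bd: "\<exists>K. \<forall>s\<in>{0..x}. \<bar>g s\<bar> \<le> K" using gx unfolding string_flow_def by (elim conjE)
      show ?thesis unfolding string_flow_def
      proof (intro conjI allI impI string_flow_measurable[OF gx] bd)
        fix u v assume uv: "0 \<le> u" "u \<le> v" "v \<le> x"
        show "g v = g u + string_slope N b t g u * (v - u) + t * (LINT s:{u<..v}|string_measure M X. (v - s) * g s)"
          using string_flow_eqs(1)[OF gx uv] unfolding i[OF uv(3)] .
        show "string_slope N b t g v = string_slope N b t g u + t * (LINT s:{u<..v}|string_measure M X. g s)"
          using string_flow_eqs(2)[OF gx uv] unfolding i[OF uv(3)] .
      qed
    qed
    moreover have "string_flow (string_measure M X) t 0 x f (string_slope M b t f)"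
      using string_flow_subinterval[OF ff] x by simp
    ultimately have d: "string_flow (string_measure M X) t 0 x (\<lambda>s. 1 * f s + (-1) * g s)
        (\<lambda>s. 1 * string_slope M b t f s + (-1) * string_slope N b t g s)"
      by (intro string_flow_linear[OF \<mu>])
    have same0: "string_measure M 0 = string_measure N 0"
    proof -
      have "M (ennreal (min s 0)) = N (ennreal (min s 0))" for s
        using eq[of 0] x by (cases "s \<le> 0") (simp_all add: min_def ennreal_neg)
      then show ?thesis unfolding string_measure_def by (simp only:)
    qed
    have "1 * f x + (-1) * g x = 0"
      by (rule string_flow_zero[OF \<mu> d t])
        (use x same0 string_solution_initial[OF f L(1)] string_solution_initial[OF g L(2)] in auto)
    then show ?thesis by simp
  qed
  have fp: "f p = a + b * p + t * (LINT s:{0..p}|string_measure M p. (p - s) * f s)"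
    using f[unfolded string_solution_def, rule_format, OF p(1,2)] by simp
  have gp: "g p = a + b * p + t * (LINT s:{0..p}|string_measure N p. (p - s) * g s)"
    using g[unfolded string_solution_def, rule_format, OF p(1,3)] by simp
  have "(LINT s:{0..p}|string_measure M p. (p - s) * f s) = (LINT s:{0..p}|string_measure N p. (p - s) * f s)"
    by (rule agree) (use p in auto)
  also have "\<dots> = (LINT s:{0..p}|string_measure N p. (p - s) * g s)"
  proof (rule set_lebesgue_integral_cong)
    show "\<forall>s. s \<in> {0..p} \<longrightarrow> (p - s) * f s = (p - s) * g s"
    proof (intro allI impI)
      fix s assume "s \<in> {0..p}"
      then show "(p - s) * f s = (p - s) * g s" using left[of s] by (cases "s = p") auto
    qed
  qed (simp add: string_measure_def)
  finally have at_p: "f p = g p" unfolding fp gp by (simp only:)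
  show "f x = g x" if x: "x \<in> {0..p}" for x
  proof (cases "x = p")
    case True
    then show ?thesis using at_p by (simp only:)
  next
    case False
    then have "0 \<le> x" "x < p" using x by auto
    then show ?thesis by (rule left)
  qed
  have split: "(LINT s:{0..p}|string_measure K p. h s) = (LINT s:{0..<p}|string_measure K p. h s)
       + h p * (enn2real (K (ennreal p)) - measure (string_measure K p) {..<p})"
    if K: "is_string K" "ennreal p < string_length K" and h: "string_solution K a b (- t) h" for K h
  proof -
    obtain Z where Z: "p < Z" "ennreal Z < string_length K" using real_strictly_between[OF K(2) p(1)] by blast
    interpret finite_borel_measure "string_measure K p" using finite_borel_measure_string[OF K(1) p(1) K(2)] .
    have \<nu>: "finite_borel_measure (string_measure K Z)" using finite_borel_measure_string[OF K(1)] Z p by simp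
    note fl = string_solution_flow[OF K(1) h t p(1) Z]
    obtain B where B: "\<And>s. s \<in> {0..p} \<Longrightarrow> \<bar>h s\<bar> \<le> B" using string_flow_bounded[OF fl] by blast
    have "set_integrable (string_measure K Z) {0..p} h"
      by (rule set_integrable_bounded[OF \<nu> _ string_flow_measurable[OF fl] B]) simp_all
    then have hi: "set_integrable (string_measure K p) {0..p} h"
      unfolding set_integrable_def
      by (subst string_integral_agree_closed(1)[OF K(1) p(1) less_imp_le[OF Z(1)] Z(2)]) auto
    have un: "{0..p} = {0..<p} \<union> {p}" using p by auto
    have "(LINT s:{0..p}|string_measure K p. h s) = (LINT s:{0..<p}|string_measure K p. h s) + (LINT s:{p}|string_measure K p. h s)"
      unfolding un by (rule set_integral_Un) (use p in \<open>auto intro!: set_integrable_subset[OF hi] simp: M_is_borel\<close>)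
    also have "(LINT s:{p}|string_measure K p. h s) = (LINT s:{p}|string_measure K p. h p)"
      by (rule set_lebesgue_integral_cong) (auto simp: M_is_borel)
    also have "\<dots> = h p * measure (string_measure K p) {p}"
      by (simp add: set_lebesgue_integral_def M_is_borel borel_UNIV mult.commute)
    also have "measure (string_measure K p) {p} = measure (string_measure K p) {..p} - measure (string_measure K p) {..<p}"
    proof -
      have "{p} = {..p} - {..<p}" "{..<p} \<subseteq> {..p}" by auto
      then show ?thesis using finite_measure_Diff[of "{..p}" "{..<p}"] by (simp add: M_is_borel)
    qed
    also have "measure (string_measure K p) {..p} = enn2real (K (ennreal p))"
      using fun_cong[OF cdf_string_measure[OF K(1) p(1) K(2)], of p] p by (simp add: cdf_def stopped_cdf_def)
    finally show ?thesis .
  qed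
  have ms: "measure (string_measure M p) {..<p} = measure (string_measure N p) {..<p}"
  proof -
    have "{..<p} \<inter> {..p} = {..<p}" by auto
    then show ?thesis using string_measure_agree_open[OF M N p(1) order.refl order.refl p(2,3) eq, of p] by simp
  qed
  have "(LINT s:{0..<p}|string_measure M p. f s) = (LINT s:{0..<p}|string_measure N p. f s)"
    by (rule agree) (use p in auto)
  also have "\<dots> = (LINT s:{0..<p}|string_measure N p. g s)"
    by (rule set_lebesgue_integral_cong) (use left in \<open>auto simp: string_measure_def\<close>)
  finally show "string_slope N b t g p = string_slope M b t f p
       + t * (enn2real (N (ennreal p)) - enn2real (M (ennreal p))) * f p"
    unfolding string_slope_def split[OF M p(2) f] split[OF N p(3) g] ms at_p
    by (simp add: algebra_simps)
qed

text \<open>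
  The function \<open>u = S(x) C - C(x) S\<close> vanishes at \<open>x\<close> and is nonnegative before it, hence convex,
  so its tangent at \<open>p\<close> is at most \<open>0\<close> at \<open>x\<close>.
\<close>

lemma string_flow_ratio_le:
  assumes \<mu>: "finite_borel_measure \<mu>" and C: "string_flow \<mu> t p x C C'" and S: "string_flow \<mu> t p x S S'"
    and t: "0 \<le> t" and init: "C p = 1" "0 \<le> C' p" "S p = 0" "S' p = 1" and px: "p \<le> x"
  shows "S x \<le> (x - p) * C x"
proof -
  define u where "u s = S x * C s + (- C x) * S s" for s
  define u' where "u' s = S x * C' s + (- C x) * S' s" for s
  have u: "string_flow \<mu> t p x u u'" unfolding u_def u'_def by (rule string_flow_linear[OF \<mu> C S])
  have nonneg: "0 \<le> u s" if s: "s \<in> {p..x}" for s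
  proof -
    have k: "string_flow \<mu> t s x (\<lambda>r. C s * S r + (- S s) * C r) (\<lambda>r. C s * S' r + (- S s) * C' r)"
      using s by (intro string_flow_linear[OF \<mu>] string_flow_subinterval[OF C] string_flow_subinterval[OF S]) auto
    have wr: "C s * S' s - C' s * S s = 1"
      using string_flow_wronskian[OF \<mu> C S t s] init by simp
    have "0 \<le> C s * S x + (- S s) * C x"
      by (rule string_flow_nonneg[OF \<mu> k t]) (use s wr in \<open>auto simp: mult.commute\<close>)
    then show ?thesis by (simp add: u_def mult.commute)
  qed
  have "0 \<le> (LINT s:{p<..x}|\<mu>. (x - s) * u s)"
    using set_integral_lower_bound[OF \<mu> _ string_flow_integrable(2)[OF \<mu> u], of p x 0] nonneg by auto
  then have "u p + u' p * (x - p) \<le> u x"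
    using string_flow_eqs(1)[OF u order.refl px order.refl] t by simp
  moreover have "u x = 0" by (simp add: u_def)
  moreover have "0 \<le> S x * C' p * (x - p)"
    using string_flow_nonneg[OF \<mu> S t, of x] init px by simp
  ultimately show ?thesis using init by (simp add: u_def u'_def algebra_simps)
qed

text \<open>
  Masses can accumulate only at the end of the string, so every earlier point is followed by a
  massless interval.
\<close>

lemma discrete_string_locally_constant:
  assumes "discrete_string N" and p: "0 \<le> p" "ennreal p < string_length N"
  obtains e where "0 < e" "ennreal (p + e) < string_length N"
    "\<And>y. p \<le> y \<Longrightarrow> y \<le> p + e \<Longrightarrow> N (ennreal y) = N (ennreal p)"
proof -
  obtain I x m where d: "\<And>s. 0 \<le> s \<Longrightarrow> ennreal s < string_length N \<Longrightarrow>
       finite {i\<in>I. x i \<le> s} \<and> N (ennreal s) = ennreal (\<Sum>i\<in>{i\<in>I. x i \<le> (s::real)}. m (i::nat))"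
    using assms(1) unfolding discrete_string_def by blast
  obtain q where q: "p < q" "ennreal q < string_length N" using real_strictly_between[OF p(2,1)] by blast
  have "finite {i\<in>I. x i \<le> q}" using d[of q] q p by auto
  then have fin: "finite (insert q (x ` {i\<in>I. p < x i \<and> x i \<le> q}))"
    by (intro finite.insertI finite_imageI) (auto elim: rev_finite_subset)
  define r where "r = Min (insert q (x ` {i\<in>I. p < x i \<and> x i \<le> q}))"
  have r: "p < r" "r \<le> q" unfolding r_def using fin q by auto
  have below: "x i \<le> p" if "i \<in> I" "x i < r" for i
  proof (rule ccontr)
    assume "\<not> x i \<le> p"
    with that r have "x i \<in> insert q (x ` {i\<in>I. p < x i \<and> x i \<le> q})" by auto
    then have "r \<le> x i" unfolding r_def using fin by (intro Min_le) auto
    with that show False by simp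
  qed
  define e where "e = (r - p) / 2"
  have e: "0 < e" "p + e < r" using r by (auto simp: e_def field_simps)
  have Lt: "ennreal y < string_length N" if "y \<le> p + e" for y
    using that e r q(2) by (meson ennreal_leI le_less_trans less_imp_le order_trans)
  have "N (ennreal y) = N (ennreal p)" if y: "p \<le> y" "y \<le> p + e" for y
  proof -
    have "{i\<in>I. x i \<le> y} = {i\<in>I. x i \<le> p}" using below e y by fastforce
    then show ?thesis using d[of y] d[of p] Lt[of y] y p by auto
  qed
  with e(1) Lt[of "p + e"] that show thesis by blast
qed

context fundamental_solutions
begin

text \<open>
  The functions \<open>C\<close> and \<open>S\<close> are the fundamental solutions started at \<open>p\<close>, where a part of the atom at \<open>p\<close> has
  already been absorbed into the slopes \<open>f1\<close>, \<open>g1\<close> and only the mass \<open>\<kappa>\<close> of it remains. Splitting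
  the atom this way lets two strings with different atoms at \<open>p\<close> start from the same data.
\<close>

lemma solutions_from_point:
  fixes p x f1 g1 \<kappa> :: real
  defines "C \<equiv> \<lambda>s. g1 * \<phi> s + (- f1) * \<psi> s" and "C' \<equiv> \<lambda>s. g1 * \<phi>' s + (- f1) * \<psi>' s"
    and "S \<equiv> \<lambda>s. \<phi> p * \<psi> s + (- \<psi> p) * \<phi> s" and "S' \<equiv> \<lambda>s. \<phi> p * \<psi>' s + (- \<psi> p) * \<phi>' s"
    and "m \<equiv> \<lambda>s. enn2real (M (ennreal s))"
  assumes p: "0 \<le> p" "p \<le> x" "ennreal x < string_length M"
    and f1: "\<phi>' p = f1 + t * \<kappa> * \<phi> p" and g1: "\<psi>' p = g1 + t * \<kappa> * \<psi> p" and \<kappa>: "0 \<le> \<kappa>"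
  shows "1 \<le> C x" "t * (\<kappa> + (m x - m p)) \<le> C' x" "S x \<le> (x - p) * C x" "x - p \<le> S x"
    and "C x * S' x - C' x * S x = 1"
    and "C x \<le> 1 + t * \<kappa> * (x - p) + t * ((x - p) * C x * (m x - m p))"
proof -
  obtain X where X: "x < X" "ennreal X < string_length M"
    using real_strictly_between[OF p(3)] p by auto
  define \<mu> where "\<mu> = string_measure M X"
  have \<mu>: "finite_borel_measure \<mu>" and f0: "string_flow \<mu> t 0 x \<phi> \<phi>'" and g0: "string_flow \<mu> t 0 x \<psi> \<psi>'"
    using flows[OF _ X] p unfolding \<mu>_def by auto
  have t: "0 \<le> t" using t_pos by simp
  have f: "string_flow \<mu> t p x \<phi> \<phi>'" and g: "string_flow \<mu> t p x \<psi> \<psi>'"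
    by (rule string_flow_subinterval[OF f0 p(1) order.refl], rule string_flow_subinterval[OF g0 p(1) order.refl])
  have W: "\<phi> p * \<psi>' p - \<phi>' p * \<psi> p = 1" by (rule wronskian[OF p])
  then have W1: "\<phi> p * g1 - f1 * \<psi> p = 1" unfolding f1 g1 by (simp add: algebra_simps)
  have C: "string_flow \<mu> t p x C C'" unfolding C_def C'_def by (rule string_flow_linear[OF \<mu> f g])
  have S: "string_flow \<mu> t p x S S'" unfolding S_def S'_def by (rule string_flow_linear[OF \<mu> g f])
  have C0: "C p = 1" using W1 by (simp add: C_def algebra_simps)
  have "C' p = t * \<kappa> * (\<phi> p * g1 - f1 * \<psi> p)" unfolding C'_def f1 g1 by (simp add: algebra_simps)
  then have C'0: "C' p = t * \<kappa>" using W1 by simp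
  have S0: "S p = 0" by (simp add: S_def)
  have S'0: "S' p = 1" using W by (simp add: S'_def algebra_simps)
  have nn: "0 \<le> C p" "0 \<le> C' p" "0 \<le> S p" "0 \<le> S' p" using C0 C'0 S0 S'0 t \<kappa> by simp_all
  have C1: "1 \<le> C s" "C s \<le> C x" if "s \<in> {p..x}" for s
    using string_flow_mono[OF \<mu> C t nn(1,2), of p s] string_flow_mono[OF \<mu> C t nn(1,2), of s x] that C0 by auto
  show C1x: "1 \<le> C x" using C1[of x] p by simp
  have mass: "measure \<mu> {p<..x} = m x - m p"
    unfolding \<mu>_def m_def by (rule string_measure_Ioc[OF string p(1,2) less_imp_le[OF X(1)] X(2)])
  note int = string_flow_integrable[OF \<mu> C order.refl order.refl]
  have "1 * measure \<mu> {p<..x} \<le> (LINT s:{p<..x}|\<mu>. C s)"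
    by (rule set_integral_lower_bound[OF \<mu> _ int(1)]) (use C1 in auto)
  then have "t * (m x - m p) \<le> t * (LINT s:{p<..x}|\<mu>. C s)"
    unfolding mass using t by (intro mult_left_mono) simp_all
  then show "t * (\<kappa> + (m x - m p)) \<le> C' x"
    using string_flow_eqs(2)[OF C order.refl p(2) order.refl] C'0 by (simp add: algebra_simps)
  show "S x \<le> (x - p) * C x"
    by (rule string_flow_ratio_le[OF \<mu> C S t C0 nn(2) S0 S'0 p(2)])
  show "x - p \<le> S x"
    using string_flow_tangent[OF \<mu> S t nn(3,4) order.refl p(2) order.refl] S0 S'0 by simp
  show "C x * S' x - C' x * S x = 1"
    using string_flow_wronskian[OF \<mu> C S t, of x] C0 S0 S'0 p by simp
  have "\<bar>LINT s:{p<..x}|\<mu>. (x - s) * C s\<bar> \<le> (x - p) * C x * measure \<mu> {p<..x}"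
  proof (rule abs_set_integral_le[OF \<mu> _ int(2)])
    fix s assume s: "s \<in> {p<..x}"
    then have "1 \<le> C s" "C s \<le> C x" using C1[of s] by auto
    then show "\<bar>(x - s) * C s\<bar> \<le> (x - p) * C x"
      unfolding abs_mult using s by (intro mult_mono) auto
  qed simp
  then have "t * (LINT s:{p<..x}|\<mu>. (x - s) * C s) \<le> t * ((x - p) * C x * (m x - m p))"
    unfolding mass using t by (intro mult_left_mono) simp_all
  then show "C x \<le> 1 + t * \<kappa> * (x - p) + t * ((x - p) * C x * (m x - m p))"
    using string_flow_eqs(1)[OF C order.refl p(2) order.refl] C0 C'0 by simp
qed

lemma solutions_across_gap:
  assumes p: "0 \<le> p" "p \<le> y" "ennreal y < string_length M" and gap: "M (ennreal y) = M (ennreal p)"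
    and h: "h = \<phi> \<and> h' = \<phi>' \<or> h = \<psi> \<and> h' = \<psi>'"
  shows "h y = h p + h' p * (y - p)"
proof -
  obtain X where X: "y < X" "ennreal X < string_length M"
    using real_strictly_between[OF p(3)] p by auto
  define \<mu> where "\<mu> = string_measure M X"
  have \<mu>: "finite_borel_measure \<mu>" and hf: "string_flow \<mu> t 0 y h h'"
    using flows[OF _ X] p h unfolding \<mu>_def by auto
  have "measure \<mu> {p<..y} = 0"
    unfolding \<mu>_def using string_measure_Ioc[OF string p(1,2) less_imp_le[OF X(1)] X(2)] gap by simp
  moreover obtain K where K: "\<And>s. s \<in> {0..y} \<Longrightarrow> \<bar>h s\<bar> \<le> K" using string_flow_bounded[OF hf] by blast
  have "\<bar>LINT s:{p<..y}|\<mu>. (y - s) * h s\<bar> \<le> (y - p) * K * measure \<mu> {p<..y}"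
  proof (rule abs_set_integral_le[OF \<mu> _ string_flow_integrable(2)[OF \<mu> hf p(1) order.refl]])
    fix s assume s: "s \<in> {p<..y}"
    then show "\<bar>(y - s) * h s\<bar> \<le> (y - p) * K"
      unfolding abs_mult using K[of s] p by (intro mult_mono) auto
  qed simp
  ultimately have "(LINT s:{p<..y}|\<mu>. (y - s) * h s) = 0" by simp
  then show ?thesis using string_flow_eqs(1)[OF hf p(1,2) order.refl] by simp
qed

end

text \<open>
  The data \<open>f1\<close>, \<open>g1\<close> below are the slopes at \<open>p\<close> after the common part of the two atoms, and \<open>C\<close>, \<open>S\<close>
  are solutions for \<open>M\<close> started from there; \<open>\<kappa>\<close> is the mass that one string has in excess. If the
  excess is with \<open>M\<close>, the comparison of \<open>\<psi>/\<phi>\<close> for \<open>N\<close> at the end of the gap with \<open>\<psi>'/\<phi>'\<close> for \<open>M\<close>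
  at \<open>x = p + d\<close> becomes \<open>e C' \<le> S'\<close>. As \<open>C S' - C' S = 1\<close> and \<open>S \<le> d C\<close>, this bounds \<open>(e - d) C'\<close>
  by \<open>1\<close>, although \<open>C' \<ge> t \<kappa>\<close>. If the excess is with \<open>N\<close>, the comparison at \<open>x > p\<close> for \<open>M\<close> and at \<open>p\<close> for \<open>N\<close>
  becomes \<open>t \<kappa> S \<le> C\<close>, although \<open>S \<ge> x - p\<close> and \<open>C\<close> is close to \<open>1\<close> when \<open>t (x - p)\<close> stays
  bounded and \<open>M\<close> has little mass in \<open>(p,x]\<close>.
\<close>

lemma no_first_difference:
  assumes M: "is_string M" "has_characteristic_function M W" and N: "is_string N" "has_characteristic_function N W"
    and p: "0 \<le> p" "ennreal p < string_length M" "ennreal p < string_length N"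
    and eq: "\<And>x. 0 \<le> x \<Longrightarrow> x < p \<Longrightarrow> M (ennreal x) = N (ennreal x)"
    and diff: "\<And>d. 0 < d \<Longrightarrow> \<exists>x. p \<le> x \<and> x < p + d \<and> M (ennreal x) \<noteq> N (ennreal x)"
    and e: "0 < e" "ennreal (p + e) < string_length N"
    and gap: "\<And>y. p \<le> y \<Longrightarrow> y \<le> p + e \<Longrightarrow> N (ennreal y) = N (ennreal p)"
  shows False
proof -
  define m where "m x = enn2real (M (ennreal x))" for x
  define n where "n x = enn2real (N (ennreal x))" for x
  have mono: "mono M" using M by (simp add: is_string_def)
  have L: "0 < string_length M" "0 < string_length N"
    using le_less_trans[OF zero_le p(2)] le_less_trans[OF zero_le p(3)] .
  have Mm: "M (ennreal x) = ennreal (m x)" if "ennreal x < string_length M" for x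
    using finite_below_string_length[OF M(1) that] by (simp add: m_def)
  have Nn: "N (ennreal p) = ennreal (n p)"
    using finite_below_string_length[OF N(1) p(3)] by (simp add: n_def)
  have m_mono: "m x \<le> m y" if "x \<le> y" "ennreal y < string_length M" for x y
    unfolding m_def using finite_below_string_length[OF M(1) that(2)] monoD[OF mono ennreal_leI[OF that(1)]]
    by (intro enn2real_mono) auto
  obtain y where y: "p < y" "ennreal y < string_length M" using real_strictly_between[OF p(2,1)] by blast
  show False
  proof (cases "n p \<le> m p")
    case True
    define d where "d = min (e / 2) (y - p)"
    have d: "0 < d" "d \<le> e / 2" "p + d \<le> y" using e y by (auto simp: d_def min_def)
    define x where "x = p + d"
    have xL: "ennreal x < string_length M"
      using d y(2) unfolding x_def by (meson ennreal_leI le_less_trans)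
    have px: "p \<le> x" using d by (simp add: x_def)
    define \<kappa> where "\<kappa> = m x - n p"
    have "n p < m x"
    proof (rule ccontr)
      assume "\<not> n p < m x"
      with True m_mono[OF px xL] have *: "m p = n p" "m x = n p" by auto
      obtain z where z: "p \<le> z" "z < p + d" "M (ennreal z) \<noteq> N (ennreal z)" using diff[OF d(1)] by blast
      have zx: "z \<le> x" using z by (simp add: x_def)
      then have zL: "ennreal z < string_length M" using xL by (meson ennreal_leI le_less_trans)
      have "m z = n p" using m_mono[OF z(1) zL] m_mono[OF zx xL] * by simp
      then have "M (ennreal z) = N (ennreal p)" using Mm[OF zL] Nn by simp
      moreover have "N (ennreal z) = N (ennreal p)" using gap[of z] z d by simp
      ultimately show False using z by simp
    qed
    then have \<kappa>: "0 < \<kappa>" by (simp add: \<kappa>_def)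
    \<comment> \<open>makes \<open>(e / 2) t \<kappa> = 2\<close>, which exceeds the bound \<open>1\<close> for \<open>(e - d) C'\<close>\<close>
    define t where "t = 4 / (e * \<kappa>)"
    have t: "0 < t" using e \<kappa> by (simp add: t_def)
    define w where "w = Re (W (complex_of_real (- t)))"
    obtain \<phi> \<psi> where fM: "fundamental_solutions M t \<phi> \<psi>"
      and GM: "w * string_slope M 0 t \<phi> x \<le> string_slope M 1 t \<psi> x"
      using characteristic_function_bounds[OF M t L(1)] xL px p unfolding w_def by (metis order_trans)
    have pe: "0 \<le> p + e" using p e by simp
    obtain \<phi>N \<psi>N where fN: "fundamental_solutions N t \<phi>N \<psi>N"
      and FN: "\<psi>N (p + e) \<le> w * \<phi>N (p + e)"
      using characteristic_function_bounds[OF N t L(2)] e(2) pe unfolding w_def by metis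
    interpret FM: fundamental_solutions M t \<phi> \<psi> by fact
    interpret FN: fundamental_solutions N t \<phi>N \<psi>N by fact
    define f1 where "f1 = string_slope N 0 t \<phi>N p"
    define g1 where "g1 = string_slope N 1 t \<psi>N p"
    define k where "k = m p - n p"
    have t0: "0 \<le> t" using t by simp
    note ag = solutions_agree[OF M(1) N(1) t0 p eq FM.\<phi> FN.\<phi>] and ag' = solutions_agree[OF M(1) N(1) t0 p eq FM.\<psi> FN.\<psi>]
    have f1: "FM.\<phi>' p = f1 + t * k * \<phi> p" using ag(2) by (simp add: f1_def k_def m_def n_def algebra_simps)
    have g1: "FM.\<psi>' p = g1 + t * k * \<psi> p" using ag'(2) by (simp add: g1_def k_def m_def n_def algebra_simps)
    have at_p: "\<phi>N p = \<phi> p" "\<psi>N p = \<psi> p" using ag(1)[of p] ag'(1)[of p] p by auto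
    have k: "0 \<le> k" using True by (simp add: k_def)
    note C = FM.solutions_from_point[OF p(1) px xL f1 g1 k]
    define C where "C = g1 * \<phi> x + (- f1) * \<psi> x"
    define C' where "C' = g1 * FM.\<phi>' x + (- f1) * FM.\<psi>' x"
    define S where "S = \<phi> p * \<psi> x + (- \<psi> p) * \<phi> x"
    define S' where "S' = \<phi> p * FM.\<psi>' x + (- \<psi> p) * FM.\<phi>' x"
    have C1: "1 \<le> C" "t * \<kappa> \<le> C'" "S \<le> d * C" "C * S' - C' * S = 1"
      using C(1,2,3,5) unfolding C_def C'_def S_def S'_def \<kappa>_def k_def m_def x_def by simp_all
    have C'0: "0 < C'" using C1(2) t \<kappa> by (smt (verit) mult_pos_pos)
    have ppe: "p \<le> p + e" using e by simp
    have Ny: "\<phi>N (p + e) = \<phi> p + f1 * e" "\<psi>N (p + e) = \<psi> p + g1 * e"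
      using FN.solutions_across_gap[OF p(1) ppe e(2) gap[OF ppe order.refl], of \<phi>N FN.\<phi>']
        FN.solutions_across_gap[OF p(1) ppe e(2) gap[OF ppe order.refl], of \<psi>N FN.\<psi>'] at_p
      unfolding f1_def g1_def by auto
    have \<phi>'x: "0 \<le> FM.\<phi>' x" using FM.\<phi>'_nonneg[OF _ order.refl xL] p px by simp
    have \<phi>N0: "0 < \<phi>N (p + e)" using FN.\<phi>_ge_1[OF pe order.refl e(2)] by simp
    have "\<psi>N (p + e) * FM.\<phi>' x \<le> w * \<phi>N (p + e) * FM.\<phi>' x"
      using FN \<phi>'x by (rule mult_right_mono)
    also have "\<dots> = \<phi>N (p + e) * (w * FM.\<phi>' x)" by simp
    also have "\<dots> \<le> \<phi>N (p + e) * FM.\<psi>' x"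
      using GM \<phi>N0 by (intro mult_left_mono) auto
    finally have "(\<psi> p + g1 * e) * FM.\<phi>' x \<le> (\<phi> p + f1 * e) * FM.\<psi>' x" unfolding Ny .
    then have main: "e * C' \<le> S'" unfolding C'_def S'_def by (simp add: algebra_simps)
    have S'C: "C * (e * C') \<le> 1 + C' * (d * C)"
    proof -
      have "C * (e * C') \<le> C * S'" using main C1(1) by (intro mult_left_mono) auto
      also have "\<dots> = 1 + C' * S" using C1(4) by simp
      also have "\<dots> \<le> 1 + C' * (d * C)" using C1(3) C'0 by (intro add_left_mono mult_left_mono) auto
      finally show ?thesis .
    qed
    have "2 = (e / 2) * (t * \<kappa>)" using e \<kappa> by (simp add: t_def)
    also have "\<dots> \<le> (e - d) * C'" using d C1(2) t \<kappa> by (intro mult_mono) auto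
    also have "\<dots> \<le> (e - d) * C' * C" using mult_left_mono[OF C1(1), of "(e - d) * C'"] C'0 d e by simp
    also have "\<dots> = C * (e * C') - C' * (d * C)" by (simp add: algebra_simps)
    also have "\<dots> \<le> 1" using S'C by simp
    finally show False by simp
  next
    case False
    define \<kappa> where "\<kappa> = n p - m p"
    have \<kappa>: "0 < \<kappa>" using False by (simp add: \<kappa>_def)
    have "(stopped_cdf M y \<longlongrightarrow> stopped_cdf M y p) (at_right p)"
      using stopped_cdf_props(2)[OF M(1) _ y(2), of p] y p by (simp add: continuous_within)
    then have "eventually (\<lambda>x. stopped_cdf M y x < stopped_cdf M y p + \<kappa> / 4) (at_right p)"
      by (rule order_tendstoD) (use \<kappa> in simp)
    moreover have "eventually (\<lambda>x. p < x \<and> x < y) (at_right p)"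
      using y(1) by (subst eventually_at_right[OF y(1)]) blast
    ultimately have "eventually (\<lambda>x. stopped_cdf M y x < stopped_cdf M y p + \<kappa> / 4 \<and> p < x \<and> x < y) (at_right p)"
      by eventually_elim simp
    then obtain x where x: "stopped_cdf M y x < stopped_cdf M y p + \<kappa> / 4" "p < x" "x < y"
      using eventually_happens trivial_limit_at_right_real by blast
    \<comment> \<open>with \<open>t = 2 / (\<kappa> (x - p))\<close> this gives \<open>C < 1 + C / 2\<close>, whereas the comparison gives \<open>C \<ge> 2\<close>\<close>
    have mx: "m x - m p < \<kappa> / 4" using x p by (simp add: stopped_cdf_def m_def min_def)
    have px: "p \<le> x" using x by simp
    have xL: "ennreal x < string_length M" using x y(2) by (meson ennreal_leI le_less_trans less_imp_le)
    define t where "t = 2 / (\<kappa> * (x - p))"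
    have t: "0 < t" using x \<kappa> by (simp add: t_def)
    define w where "w = Re (W (complex_of_real (- t)))"
    obtain \<phi> \<psi> where fM: "fundamental_solutions M t \<phi> \<psi>" and FM: "\<psi> x \<le> w * \<phi> x"
      using characteristic_function_bounds[OF M t L(1)] xL px p unfolding w_def by (metis order_trans)
    obtain \<phi>N \<psi>N where fN: "fundamental_solutions N t \<phi>N \<psi>N"
      and GN: "w * string_slope N 0 t \<phi>N p \<le> string_slope N 1 t \<psi>N p"
      using characteristic_function_bounds[OF N t L(2)] p unfolding w_def by metis
    interpret FM: fundamental_solutions M t \<phi> \<psi> by fact
    interpret FN: fundamental_solutions N t \<phi>N \<psi>N by fact
    define f1 where "f1 = FM.\<phi>' p"
    define g1 where "g1 = FM.\<psi>' p"
    have t0: "0 \<le> t" using t by simp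
    note ag = solutions_agree[OF M(1) N(1) t0 p eq FM.\<phi> FN.\<phi>] and ag' = solutions_agree[OF M(1) N(1) t0 p eq FM.\<psi> FN.\<psi>]
    have s: "FN.\<phi>' p = f1 + t * \<kappa> * \<phi> p" "FN.\<psi>' p = g1 + t * \<kappa> * \<psi> p"
      using ag(2) ag'(2) by (simp_all add: f1_def g1_def \<kappa>_def m_def n_def)
    have k0: "FM.\<phi>' p = f1 + t * 0 * \<phi> p" "FM.\<psi>' p = g1 + t * 0 * \<psi> p" by (simp_all add: f1_def g1_def)
    note C = FM.solutions_from_point[OF p(1) px xL k0 order.refl]
    define C where "C = g1 * \<phi> x + (- f1) * \<psi> x"
    define S where "S = \<phi> p * \<psi> x + (- \<psi> p) * \<phi> x"
    have C1: "1 \<le> C" "x - p \<le> S" "C \<le> 1 + t * ((x - p) * C * (m x - m p))"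
      using C(1,4,6) unfolding C_def S_def m_def by simp_all
    have \<phi>x: "0 < \<phi> x" using FM.\<phi>_ge_1[OF _ order.refl xL] p px by simp
    have \<phi>'p: "0 \<le> FN.\<phi>' p" using FN.\<phi>'_nonneg[OF p(1) order.refl p(3)] .
    have "\<psi> x * FN.\<phi>' p \<le> w * \<phi> x * FN.\<phi>' p" using FM \<phi>'p by (rule mult_right_mono)
    also have "\<dots> = \<phi> x * (w * FN.\<phi>' p)" by simp
    also have "\<dots> \<le> \<phi> x * FN.\<psi>' p" using GN \<phi>x by (intro mult_left_mono) auto
    finally have "t * \<kappa> * S \<le> C" unfolding s C_def S_def by (simp add: algebra_simps)
    moreover have "t * \<kappa> * (x - p) \<le> t * \<kappa> * S" using C1(2) t \<kappa> by (intro mult_left_mono) auto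
    moreover have t2: "t * \<kappa> * (x - p) = 2"
    proof -
      have "\<kappa> * (x - p) \<noteq> 0" using x \<kappa> by simp
      then have "t * (\<kappa> * (x - p)) = 2" using nonzero_eq_divide_eq[of "\<kappa> * (x - p)" t 2] t_def by blast
      then show ?thesis by (simp only: mult.assoc)
    qed
    ultimately have 2: "2 \<le> C" by simp
    have "t * ((x - p) * C * (m x - m p)) < t * ((x - p) * C * (\<kappa> / 4))"
      using mx x t C1(1) by (intro mult_strict_left_mono) auto
    also have "\<dots> = (t * \<kappa> * (x - p)) * C / 4" by simp
    also have "\<dots> = C / 2" unfolding t2 by simp
    finally show False using C1(3) 2 by linarith
  qed
qed

text \<open>
  If \<open>M\<close> ends at \<open>p\<close> and \<open>N\<close> continues, then \<open>W\<close> is at most \<open>\<psi>/\<phi>\<close> at \<open>p\<close> for \<open>N\<close>, but \<open>\<psi>/\<phi>\<close> for \<open>N\<close> increases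
  strictly beyond \<open>p\<close> and never exceeds \<open>W\<close>.
\<close>

lemma no_length_mismatch:
  assumes M: "is_string M" "has_characteristic_function M W" and N: "is_string N" "has_characteristic_function N W"
    and p: "0 \<le> p" "ennreal p = string_length M" "ennreal p < string_length N"
    and eq: "\<And>x. 0 \<le> x \<Longrightarrow> x < p \<Longrightarrow> M (ennreal x) = N (ennreal x)"
  shows False
proof -
  have LN: "0 < string_length N" using le_less_trans[OF zero_le p(3)] .
  define w where "w = Re (W (complex_of_real (- 1)))"
  obtain \<phi>N \<psi>N where fN: "fundamental_solutions N 1 \<phi>N \<psi>N"
    and FN: "\<And>x. 0 \<le> x \<Longrightarrow> ennreal x < string_length N \<Longrightarrow> \<psi>N x \<le> w * \<phi>N x"
    using characteristic_function_bounds[OF N _ LN, of 1] unfolding w_def by (metis zero_less_one)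
  interpret FN: fundamental_solutions N 1 \<phi>N \<psi>N by fact
  obtain y where y: "p < y" "ennreal y < string_length N" using real_strictly_between[OF p(3,1)] by blast
  have y0: "0 \<le> y" using y p by simp
  have w_gt: "\<psi>N p < w * \<phi>N p"
  proof -
    have "\<psi>N p * \<phi>N y < \<phi>N p * \<psi>N y" using FN.ratio_increasing[OF p(1) less_imp_le[OF y(1)] y(2)] y by linarith
    also have "\<dots> \<le> \<phi>N p * (w * \<phi>N y)"
      using FN[OF y0 y(2)] FN.\<phi>_ge_1[OF p(1) order.refl p(3)] by (intro mult_left_mono) auto
    finally have "\<psi>N p * \<phi>N y < (w * \<phi>N p) * \<phi>N y" by (simp add: mult_ac)
    then show ?thesis using FN.\<phi>_ge_1[OF y0 order.refl y(2)] by (simp add: mult_less_cancel_right)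
  qed
  have \<phi>p: "1 \<le> \<phi>N p" by (rule FN.\<phi>_ge_1[OF p(1) order.refl p(3)])
  show False
  proof (cases "string_length M = 0")
    case True
    then have "W (complex_of_real (- 1)) = 0" using M(2) unfolding has_characteristic_function_def by (metis neg_less_0_iff_less zero_less_one)
    then have "w = 0" by (simp add: w_def)
    then show False using w_gt FN.\<psi>_ge[OF p(1) order.refl p(3)] p(1) by simp
  next
    case False
    then have LM: "0 < string_length M" by (simp add: zero_less_iff_neq_zero)
    obtain \<phi> \<psi> where fM: "fundamental_solutions M 1 \<phi> \<psi>"
      and lim: "((\<lambda>x. \<psi> (enn2real x) / \<phi> (enn2real x)) \<longlongrightarrow> w) (at_left (string_length M))"
      using characteristic_function_bounds[OF M _ LM, of 1] unfolding w_def by (metis zero_less_one)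
    interpret FM: fundamental_solutions M 1 \<phi> \<psi> by fact
    have "eventually (\<lambda>x. \<psi> (enn2real x) / \<phi> (enn2real x) \<le> \<psi>N p / \<phi>N p) (at_left (string_length M))"
    proof -
      have "eventually (\<lambda>y. 0 \<le> enn2real y \<and> ennreal (enn2real y) = y \<and> y < string_length M) (at_left (string_length M))"
        using eventually_at_left_ennreal_between[of 0 "string_length M"] LM by simp
      then show ?thesis
    proof eventually_elim
      case (elim x)
      define q where "q = enn2real x"
      have q: "0 \<le> q" "ennreal q < string_length M" using elim by (simp_all add: q_def)
      have qp: "q < p" using q p(1,2) by (metis ennreal_less_iff)
      have qN: "ennreal q < string_length N" using q p by (metis order.strict_trans)
      have "\<phi> q = \<phi>N q" "\<psi> q = \<psi>N q"
        using solutions_agree(1)[OF M(1) N(1) zero_le_one q qN _ FM.\<phi> FN.\<phi>, of q]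
          solutions_agree(1)[OF M(1) N(1) zero_le_one q qN _ FM.\<psi> FN.\<psi>, of q] eq q qp by auto
      moreover have "\<psi>N q * \<phi>N p \<le> \<phi>N q * \<psi>N p"
        using FN.ratio_increasing[OF q(1) less_imp_le[OF qp] p(3)] qp by simp
      moreover have "1 \<le> \<phi>N q" by (rule FN.\<phi>_ge_1[OF q(1) order.refl qN])
      ultimately show ?case using \<phi>p unfolding q_def[symmetric] by (simp add: field_simps)
    qed
    qed
    then have "w \<le> \<psi>N p / \<phi>N p"
      by (rule tendsto_upperbound[OF lim _ at_left_ennreal_nontrivial[OF LM]])
    then show False using w_gt \<phi>p by (simp add: field_simps)
  qed
qed

text \<open>
  Both strings reach the infimum \<open>p\<close> of the set where they differ, since a string that ends before \<open>p\<close> is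
  infinite from there on and takes the other one with it. What remains is to exclude the possible
  positions of \<open>p\<close> relative to the two lengths.
\<close>

theorem discrete_string_unique:
  assumes M: "is_string M" "has_characteristic_function M W"
    and N: "discrete_string N" "has_characteristic_function N W"
  shows "M = N"
proof (rule ccontr)
  assume "M \<noteq> N"
  have Ns: "is_string N" using N(1) by (simp add: discrete_string_def)
  define E where "E = {x. 0 \<le> x \<and> M (ennreal x) \<noteq> N (ennreal x)}"
  have "E \<noteq> {}"
  proof
    assume "E = {}"
    then have "M (ennreal x) = N (ennreal x)" if "0 \<le> x" for x using that unfolding E_def by auto
    moreover have "M \<top> = N \<top>" using M(1) Ns by (simp add: is_string_def)
    ultimately have "M x = N x" for x by (cases x) auto
    with \<open>M \<noteq> N\<close> show False by auto
  qed
  have bdd: "bdd_below E" unfolding E_def by (intro bdd_belowI[of _ 0]) auto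
  define p where "p = Inf E"
  have p0: "0 \<le> p" unfolding p_def using \<open>E \<noteq> {}\<close> by (intro cInf_greatest) (auto simp: E_def)
  have eq: "M (ennreal x) = N (ennreal x)" if "0 \<le> x" "x < p" for x
    using that cInf_lower[OF _ bdd, of x] unfolding p_def E_def by force
  have diff: "\<exists>x. p \<le> x \<and> x < p + d \<and> M (ennreal x) \<noteq> N (ennreal x)" if "0 < d" for d
  proof -
    have "Inf E < p + d" using that by (simp add: p_def)
    then obtain x where "x \<in> E" "x < p + d" using cInf_lessD[OF \<open>E \<noteq> {}\<close>] by blast
    moreover have "p \<le> x" using cInf_lower[OF \<open>x \<in> E\<close> bdd] by (simp add: p_def)
    ultimately show ?thesis by (auto simp: E_def)
  qed
  have reach: "ennreal p \<le> string_length K"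
    if K: "is_string K" "is_string K'" and agree: "\<And>x. 0 \<le> x \<Longrightarrow> x < p \<Longrightarrow> K (ennreal x) = K' (ennreal x)"
      and dis: "\<exists>x. p \<le> x \<and> K (ennreal x) \<noteq> K' (ennreal x)" for K K'
  proof (rule ccontr)
    assume "\<not> ennreal p \<le> string_length K"
    then have "string_length K < ennreal p" by (rule not_le_imp_less)
    then obtain r where r: "string_length K < r" "r < ennreal p" using dense[of "string_length K" "ennreal p"] by auto
    then have "r < \<top>" using less_le_trans top_greatest by metis
    then have e: "ennreal (enn2real r) = r" by simp
    define q where "q = enn2real r"
    have q: "0 \<le> q" "q < p" "string_length K \<le> ennreal q"
      using r ennreal_less_iff[of q p] unfolding q_def e by auto
    have inf: "K (ennreal q) = \<infinity>" by (rule infinite_from_string_length[OF K(1) q(3)])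
    have inf': "K' (ennreal q) = \<infinity>" using agree[OF q(1,2)] inf by simp
    have "K (ennreal x) = K' (ennreal x)" if "p \<le> x" for x
    proof -
      have "ennreal q \<le> ennreal x" using that q by (intro ennreal_leI) simp
      then have "K (ennreal q) \<le> K (ennreal x)" "K' (ennreal q) \<le> K' (ennreal x)"
        using K by (auto simp: is_string_def monoD)
      then show ?thesis using inf inf' by (simp add: top.extremum_unique)
    qed
    with dis show False by blast
  qed
  have dis: "\<exists>x. p \<le> x \<and> M (ennreal x) \<noteq> N (ennreal x)" using diff[of 1] by auto
  have pM: "ennreal p \<le> string_length M" using reach[OF M(1) Ns eq dis] .
  have pN: "ennreal p \<le> string_length N" using reach[OF Ns M(1)] eq dis by metis
  consider "ennreal p = string_length M" "ennreal p = string_length N"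
    | "ennreal p = string_length M" "ennreal p < string_length N"
    | "ennreal p < string_length M" "ennreal p = string_length N"
    | "ennreal p < string_length M" "ennreal p < string_length N"
    using pM pN le_less by blast
  then show False
  proof cases
    case 1
    obtain x where x: "p \<le> x" "M (ennreal x) \<noteq> N (ennreal x)" using dis by blast
    have "ennreal p \<le> ennreal x" using x by (intro ennreal_leI)
    then have "M (ennreal x) = \<infinity>" "N (ennreal x) = \<infinity>"
      using infinite_from_string_length[OF M(1)] infinite_from_string_length[OF Ns] 1 by auto
    with x show False by simp
  next
    case 2
    show False by (rule no_length_mismatch[OF M Ns N(2) p0 2 eq])
  next
    case 3
    show False by (rule no_length_mismatch[OF Ns N(2) M p0 3(2,1) eq[symmetric]])
  next
    case 4
    obtain e where e: "0 < e" "ennreal (p + e) < string_length N"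
      "\<And>y. p \<le> y \<Longrightarrow> y \<le> p + e \<Longrightarrow> N (ennreal y) = N (ennreal p)"
      using discrete_string_locally_constant[OF N(1) p0 4(2)] by blast
    show False by (rule no_first_difference[OF M Ns N(2) p0 4 eq diff e])
  qed
qed

section \<open>Finite strings of beads\<close>

text \<open>
  A finite string is given by a list of pairs \<open>(l, m)\<close>: after a massless piece of length \<open>l\<close> follows a bead of
  mass \<open>m\<close>. The end is \<open>Some l\<close> for a last massless piece of length \<open>l\<close>, or \<open>None\<close> for one of infinite length.
\<close>

fun bead_position :: "(real \<times> real) list \<Rightarrow> nat \<Rightarrow> real" where
  "bead_position [] i = 0"
| "bead_position ((l, m) # r) 0 = l"
| "bead_position ((l, m) # r) (Suc i) = l + bead_position r i"

text \<open>
  The integral of \<open>g\<close> over \<open>[0,x]\<close> with respect to the beads.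
\<close>

fun bead_sum :: "(real \<times> real) list \<Rightarrow> (real \<Rightarrow> real) \<Rightarrow> real \<Rightarrow> real" where
  "bead_sum [] g x = 0"
| "bead_sum ((l, m) # r) g x = (if x < l then 0 else m * g l + bead_sum r (\<lambda>s. g (s + l)) (x - l))"

fun beads_length :: "(real \<times> real) list \<Rightarrow> real option \<Rightarrow> ennreal" where
  "beads_length xs (Some e) = ennreal (sum_list (map fst xs) + e)"
| "beads_length xs None = \<infinity>"

definition bead_string :: "(real \<times> real) list \<Rightarrow> real option \<Rightarrow> ennreal \<Rightarrow> ennreal" where
  "bead_string xs e x =
     (if x < beads_length xs e then ennreal (bead_sum xs (\<lambda>_. 1) (enn2real x)) else \<infinity>)"

text \<open>
  The flag demands a positive first gap. It is off at the beginning of the string, where a bead at \<open>0\<close> is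
  possible, and on for all later beads, which keeps the positions distinct.
\<close>

fun valid_beads :: "bool \<Rightarrow> (real \<times> real) list \<Rightarrow> bool" where
  "valid_beads b [] \<longleftrightarrow> True"
| "valid_beads b ((l, m) # r) \<longleftrightarrow> 0 \<le> l \<and> (b \<longrightarrow> l \<noteq> 0) \<and> 0 < m \<and> valid_beads True r"

text \<open>
  An infinite string without beads is excluded: its characteristic function is infinite.
\<close>

definition valid_end :: "(real \<times> real) list \<Rightarrow> real option \<Rightarrow> bool" where
  "valid_end xs e \<longleftrightarrow> (case e of Some l \<Rightarrow> 0 < l | None \<Rightarrow> xs \<noteq> [])"

lemma bead_position_nonneg: "valid_beads b xs \<Longrightarrow> i < length xs \<Longrightarrow> 0 \<le> bead_position xs i"
  by (induction b xs arbitrary: i rule: valid_beads.induct) (auto split: nat.split simp: less_Suc_eq_0_disj)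

lemma bead_position_pos: "valid_beads True xs \<Longrightarrow> i < length xs \<Longrightarrow> 0 < bead_position xs i"
  by (cases xs; cases i) (auto intro!: add_pos_nonneg bead_position_nonneg)

lemma total_bead_length_nonneg: "valid_beads b xs \<Longrightarrow> 0 \<le> sum_list (map fst xs)"
  by (induction b xs rule: valid_beads.induct) auto

lemma bead_position_le_total:
  "valid_beads b xs \<Longrightarrow> i < length xs \<Longrightarrow> bead_position xs i \<le> sum_list (map fst xs)"
proof (induction b xs arbitrary: i rule: valid_beads.induct)
  case (2 b l m r)
  have "0 \<le> sum_list (map fst r)"
    using 2(2) by (intro total_bead_length_nonneg[of True]) simp
  then show ?case using 2 by (cases i) auto
qed simp

lemma inj_on_bead_position: "valid_beads b xs \<Longrightarrow> inj_on (bead_position xs) {..<length xs}"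
proof (induction b xs rule: valid_beads.induct)
  case (2 b l m r)
  have "inj_on (bead_position ((l, m) # r)) (insert 0 (Suc ` {..<length r}))"
  proof (subst inj_on_insert, intro conjI)
    show "inj_on (bead_position ((l, m) # r)) (Suc ` {..<length r})"
      using 2 by (auto simp: inj_on_def)
    show "bead_position ((l, m) # r) 0 \<notin> bead_position ((l, m) # r) ` (Suc ` {..<length r} - {0})"
      using 2(2) bead_position_pos[of r] by force
  qed
  also have "insert 0 (Suc ` {..<length r}) = {..<length ((l, m) # r)}" by (simp add: lessThan_Suc_eq_insert_0)
  finally show ?case .
qed simp

lemma bead_sum_eq:
  "valid_beads b xs \<Longrightarrow> bead_sum xs g x =
     (\<Sum>i\<in>{i. i < length xs \<and> bead_position xs i \<le> x}. snd (xs ! i) * g (bead_position xs i))"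
proof (induction b xs arbitrary: g x rule: valid_beads.induct)
  case (2 b l m r)
  show ?case
  proof (cases "x < l")
    case True
    have "{i. i < length ((l, m) # r) \<and> bead_position ((l, m) # r) i \<le> x} = {}"
    proof -
      have "\<not> bead_position ((l, m) # r) i \<le> x" if "i < length ((l, m) # r)" for i
        using that True 2(2) bead_position_nonneg[of True r "i - 1"] by (cases i) auto
      then show ?thesis by blast
    qed
    moreover have "bead_sum ((l, m) # r) g x = 0" using True by simp
    ultimately show ?thesis by (simp only: sum.empty)
  next
    case False
    let ?A = "{i. i < length r \<and> bead_position r i \<le> x - l}"
    have "{i. i < length ((l, m) # r) \<and> bead_position ((l, m) # r) i \<le> x} = insert 0 (Suc ` ?A)"
    proof (intro set_eqI)
      fix i show "i \<in> {i. i < length ((l, m) # r) \<and> bead_position ((l, m) # r) i \<le> x} \<longleftrightarrow> i \<in> insert 0 (Suc ` ?A)"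
        using False by (cases i) auto
    qed
    moreover have "(\<Sum>i\<in>insert 0 (Suc ` ?A). snd (((l, m) # r) ! i) * g (bead_position ((l, m) # r) i))
      = m * g l + (\<Sum>i\<in>?A. snd (r ! i) * g (bead_position r i + l))"
      by (subst sum.insert) (auto simp: sum.reindex add.commute)
    ultimately show ?thesis using 2 False by simp
  qed
qed simp

lemma bead_sum_cong:
  "valid_beads b xs \<Longrightarrow> (\<And>s. 0 \<le> s \<Longrightarrow> g s = h s) \<Longrightarrow> bead_sum xs g x = bead_sum xs h x"
  by (simp add: bead_sum_eq bead_position_nonneg cong: sum.cong_simp)

lemma bead_mass_pos: "valid_beads b xs \<Longrightarrow> i < length xs \<Longrightarrow> 0 < snd (xs ! i)"
  by (induction b xs arbitrary: i rule: valid_beads.induct) (auto simp: less_Suc_eq_0_disj)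

lemma bead_sum_mono:
  assumes "valid_beads b xs" "x \<le> y"
  shows "bead_sum xs (\<lambda>_. 1) x \<le> bead_sum xs (\<lambda>_. 1) y"
  unfolding bead_sum_eq[OF assms(1)]
  by (rule sum_mono2) (use assms bead_mass_pos[OF assms(1)] in \<open>auto intro: less_imp_le\<close>)

lemma bead_sum_nonneg:
  assumes "valid_beads b xs"
  shows "0 \<le> bead_sum xs (\<lambda>_. 1) x"
  unfolding bead_sum_eq[OF assms(1)]
  by (rule sum_nonneg) (use bead_mass_pos[OF assms(1)] in \<open>auto intro: less_imp_le\<close>)

text \<open>
  Positions are reached from the right, so there is a bead-free interval after every point; this is
  the right-continuity of the string.
\<close>

lemma bead_sum_locally_constant:
  "\<exists>d>0. \<forall>y. x \<le> y \<and> y < x + d \<longrightarrow> bead_sum xs g y = bead_sum xs g x"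
proof (induction xs arbitrary: g x)
  case (Cons lm r)
  obtain l m where lm: "lm = (l, m)" by force
  show ?case
  proof (cases "x < l")
    case True
    then show ?thesis unfolding lm by (intro exI[of _ "l - x"]) auto
  next
    case False
    obtain d where d: "d > 0" "\<forall>y. x - l \<le> y \<and> y < x - l + d \<longrightarrow>
        bead_sum r (\<lambda>s. g (s + l)) y = bead_sum r (\<lambda>s. g (s + l)) (x - l)"
      using Cons[of "x - l" "\<lambda>s. g (s + l)"] by (elim exE conjE)
    have "bead_sum ((l, m) # r) g y = bead_sum ((l, m) # r) g x" if "x \<le> y" "y < x + d" for y
      using d(2)[rule_format, of "y - l"] that False by simp
    then show ?thesis unfolding lm using d(1) by blast
  qed
qed (auto intro: exI[of _ 1])

lemma beads_length_pos:
  assumes "valid_beads b xs" "valid_end xs e"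
  shows "0 < beads_length xs e"
  using assms total_bead_length_nonneg[of b xs]
  by (cases e) (auto simp: valid_end_def add_nonneg_pos simp del: ennreal_plus)

lemma bead_string_is_string:
  assumes ok: "valid_beads b xs"
  shows "is_string (bead_string xs e)"
  unfolding is_string_def
proof (intro conjI allI)
  show "mono (bead_string xs e)"
  proof (rule monoI)
    fix x y :: ennreal assume xy: "x \<le> y"
    show "bead_string xs e x \<le> bead_string xs e y"
    proof (cases "y < beads_length xs e")
      case True
      then have "y < \<top>" using less_le_trans top_greatest by metis
      then have "enn2real x \<le> enn2real y" using xy by (intro enn2real_mono)
      moreover have "x < beads_length xs e" using xy True by (rule le_less_trans)
      ultimately show ?thesis using True by (simp add: bead_string_def ennreal_leI bead_sum_mono[OF ok])
    qed (simp add: bead_string_def)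
  qed
  show "bead_string xs e \<infinity> = \<infinity>" by (simp add: bead_string_def)
  fix x :: ennreal
  have "eventually (\<lambda>y. bead_string xs e y = bead_string xs e x) (at_right x)"
  proof (cases "x < beads_length xs e")
    case True
    then have "x < \<top>" using less_le_trans top_greatest by metis
    then have ex: "ennreal (enn2real x) = x" by simp
    obtain d where d: "d > 0" "\<forall>y. enn2real x \<le> y \<and> y < enn2real x + d \<longrightarrow>
        bead_sum xs (\<lambda>_. 1) y = bead_sum xs (\<lambda>_. 1) (enn2real x)"
      using bead_sum_locally_constant[of "enn2real x" xs "\<lambda>_. 1"] by (elim exE conjE)
    have up: "x < ennreal (enn2real x + d)"
      using d(1) ennreal_less_iff[OF enn2real_nonneg[of x], of "enn2real x + d"] unfolding ex by simp
    have "eventually (\<lambda>y. y < ennreal (enn2real x + d)) (at_right x)" "eventually (\<lambda>y. y < beads_length xs e) (at_right x)"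
      "eventually (\<lambda>y. x < y) (at_right x)"
      using up True by (auto simp: eventually_at_right[OF True])
    then show ?thesis
    proof eventually_elim
      case (elim y)
      then have "y < \<top>" using less_le_trans top_greatest by metis
      then have ey: "ennreal (enn2real y) = y" by simp
      have "enn2real x \<le> enn2real y" using elim \<open>y < \<top>\<close> by (intro enn2real_mono) auto
      moreover have "enn2real y < enn2real x + d"
        using elim(1) ennreal_less_iff[OF enn2real_nonneg[of y], of "enn2real x + d"] unfolding ey by (simp only:)
      ultimately have "bead_sum xs (\<lambda>_. 1) (enn2real y) = bead_sum xs (\<lambda>_. 1) (enn2real x)"
        by (intro d(2)[rule_format]) simp
      then show ?case using elim(2) True unfolding bead_string_def by (simp only: if_True)
    qed
  next
    case False
    have "eventually (\<lambda>y. x < y) (at_right x)" by (simp add: eventually_at_filter)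
    then show ?thesis
      by eventually_elim (use False in \<open>auto simp: bead_string_def\<close>)
  qed
  then show "continuous (at_right x) (bead_string xs e)"
    unfolding continuous_within by (rule tendsto_eventually)
qed

lemma string_length_bead_string: "string_length (bead_string xs e) = beads_length xs e"
proof -
  have "{x. x < \<infinity> \<and> bead_string xs e x < \<infinity>} = {..<beads_length xs e}"
    by (auto simp: bead_string_def top.not_eq_extremum split: if_splits elim: less_le_trans)
  then show ?thesis unfolding string_length_def by (simp add: Sup_lessThan)
qed

lemma bead_string_discrete:
  assumes ok: "valid_beads b xs" "valid_end xs e"
  shows "discrete_string (bead_string xs e)"
  unfolding discrete_string_def string_length_bead_string
proof (intro conjI bead_string_is_string[OF ok(1)] exI)
  let ?I = "{..<length xs}" and ?m = "\<lambda>i. snd (xs ! i)"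
  show "\<forall>i\<in>?I. 0 \<le> bead_position xs i \<and> ennreal (bead_position xs i) < beads_length xs e \<and> 0 < ?m i"
  proof (intro ballI conjI)
    fix i assume i: "i \<in> ?I"
    then show p: "0 \<le> bead_position xs i" and "0 < ?m i"
      using bead_position_nonneg[OF ok(1)] bead_mass_pos[OF ok(1)] by auto
    show "ennreal (bead_position xs i) < beads_length xs e"
      using bead_position_le_total[OF ok(1), of i] i ok(2) p
      by (cases e) (auto simp: valid_end_def ennreal_less_iff simp del: ennreal_plus)
  qed
  show "inj_on (bead_position xs) ?I" by (rule inj_on_bead_position[OF ok(1)])
  show "\<forall>t\<ge>0. ennreal t < beads_length xs e \<longrightarrow> finite {i \<in> ?I. bead_position xs i \<le> t} \<and>
     bead_string xs e (ennreal t) = ennreal (\<Sum>i\<in>{i \<in> ?I. bead_position xs i \<le> t}. ?m i)"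
    by (auto simp: bead_string_def bead_sum_eq[OF ok(1)] intro!: arg_cong[where f=ennreal] sum.cong)
  show "\<forall>y\<ge>beads_length xs e. bead_string xs e y = \<infinity>" by (auto simp: bead_string_def)
qed

text \<open>
  The stopped measure of a finite string is the image of a finite point measure on the indices of
  the beads, having the same distribution function.
\<close>

lemma
  assumes ok: "valid_beads b xs" and x: "0 \<le> x" "ennreal x < beads_length xs e"
    and h: "h \<in> borel_measurable borel"
  shows bead_string_integrable: "set_integrable (string_measure (bead_string xs e) x) {0..x} h"
    and bead_string_integral: "(LINT s:{0..x}|string_measure (bead_string xs e) x. h s) = bead_sum xs h x"
proof -
  let ?M = "bead_string xs e" and ?P = "bead_position xs"
  define A where "A = {i. i < length xs \<and> ?P i \<le> x}"
  define m where "m i = snd (xs ! i)" for i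
  have A: "finite A" by (simp add: A_def)
  have m: "0 \<le> m i" if "i \<in> A" for i using bead_mass_pos[OF ok, of i] that by (auto simp: A_def m_def)
  have P: "0 \<le> ?P i" "?P i \<le> x" if "i \<in> A" for i using bead_position_nonneg[OF ok, of i] that by (auto simp: A_def)
  define \<nu> where "\<nu> = distr (point_measure A m) borel ?P"
  have Pm: "?P \<in> measurable (point_measure A m) borel" by (simp add: point_measure_def)
  have fin: "finite_measure \<nu>"
    unfolding \<nu>_def
    by (intro finite_measure.finite_measure_distr[OF _ Pm] finite_measureI)
       (use A in \<open>simp add: space_point_measure emeasure_point_measure_finite\<close>)
  have \<nu>: "finite_borel_measure \<nu>"
    by (intro finite_borel_measure.intro fin finite_borel_measure_axioms.intro) (simp add: \<nu>_def)
  have S: "is_string ?M" by (rule bead_string_is_string[OF ok])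
  have X: "ennreal x < string_length ?M" using x by (simp add: string_length_bead_string)
  have eq: "string_measure ?M x = \<nu>"
  proof (rule cdf_unique'[OF finite_borel_measure_string[OF S x(1) X] \<nu>], rule ext)
    fix y
    have "emeasure \<nu> {..y} = (\<Sum>i\<in>{i\<in>A. ?P i \<le> y}. ennreal (m i))"
    proof -
      have "emeasure \<nu> {..y} = emeasure (point_measure A m) (?P -` {..y} \<inter> A)"
        unfolding \<nu>_def by (subst emeasure_distr[OF Pm]) (simp_all add: space_point_measure)
      also have "?P -` {..y} \<inter> A = {i\<in>A. ?P i \<le> y}" by auto
      finally show ?thesis by (simp add: emeasure_point_measure_finite A)
    qed
    also have "\<dots> = ennreal (\<Sum>i\<in>{i\<in>A. ?P i \<le> y}. m i)" using m by (intro sum_ennreal) auto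
    finally have em: "emeasure \<nu> {..y} = ennreal (\<Sum>i\<in>{i\<in>A. ?P i \<le> y}. m i)" .
    have "0 \<le> (\<Sum>i\<in>{i\<in>A. ?P i \<le> y}. m i)" using m by (intro sum_nonneg) auto
    then have c: "cdf \<nu> y = (\<Sum>i\<in>{i\<in>A. ?P i \<le> y}. m i)"
      unfolding cdf_def measure_def em by (rule enn2real_ennreal)
    have "stopped_cdf ?M x y = (\<Sum>i\<in>{i\<in>A. ?P i \<le> y}. m i)"
    proof (cases "y < 0")
      case True
      then have none: "{i\<in>A. ?P i \<le> y} = {}" using P by force
      show ?thesis using True unfolding none by (simp add: stopped_cdf_def)
    next
      case False
      have "ennreal (min y x) < beads_length xs e" using x(2) by (meson ennreal_leI le_less_trans min.cobounded2)
      then have "stopped_cdf ?M x y = bead_sum xs (\<lambda>_. 1) (min y x)"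
        using False x bead_sum_nonneg[OF ok] by (simp add: stopped_cdf_def bead_string_def)
      also have "\<dots> = (\<Sum>i\<in>{i\<in>A. ?P i \<le> y}. m i)"
        unfolding bead_sum_eq[OF ok] by (rule sum.cong) (auto simp: A_def m_def)
      finally show ?thesis .
    qed
    then show "cdf (string_measure ?M x) y = cdf \<nu> y"
      using c fun_cong[OF cdf_string_measure[OF S x(1) X], of y] by simp
  qed
  have hm: "(\<lambda>s. indicator {0..x} s *\<^sub>R h s) \<in> borel_measurable borel" using h by simp
  show "set_integrable (string_measure ?M x) {0..x} h"
    unfolding set_integrable_def eq \<nu>_def integrable_distr_eq[OF Pm hm]
    using m by (intro integrable_point_measure_finite A) 
  have "(LINT s:{0..x}|string_measure ?M x. h s) = (\<Sum>i\<in>A. m i *\<^sub>R (indicator {0..x} (?P i) *\<^sub>R h (?P i)))"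
    unfolding set_lebesgue_integral_def eq \<nu>_def integral_distr[OF Pm hm]
    using m by (intro lebesgue_integral_point_measure_finite A)
  also have "\<dots> = bead_sum xs h x"
    unfolding bead_sum_eq[OF ok] A_def[symmetric] using P by (intro sum.cong) (auto simp: m_def)
  finally show "(LINT s:{0..x}|string_measure ?M x. h s) = bead_sum xs h x" .
qed

text \<open>
  Linear between beads; passing a bead of mass \<open>m\<close> increases the slope by \<open>t m\<close> times the value.
\<close>

fun bead_solution :: "(real \<times> real) list \<Rightarrow> real \<Rightarrow> real \<Rightarrow> real \<Rightarrow> real \<Rightarrow> real" where
  "bead_solution [] t a b x = a + b * x"
| "bead_solution ((l, m) # r) t a b x =
     (if x < l then a + b * x else bead_solution r t (a + b * l) (b + t * m * (a + b * l)) (x - l))"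

lemma bead_solution_measurable: "bead_solution xs t a b \<in> borel_measurable borel"
proof (induction xs arbitrary: a b)
  case Nil
  have "bead_solution [] t a b = (\<lambda>x. a + b * x)" by auto
  then show ?case by simp
next
  case (Cons lm r)
  obtain l m where lm: "lm = (l, m)" by force
  have [measurable]: "bead_solution r t (a + b * l) (b + t * m * (a + b * l)) \<in> borel_measurable borel" by (rule Cons)
  have "bead_solution (lm # r) t a b = (\<lambda>x. if x < l then a + b * x else bead_solution r t (a + b * l) (b + t * m * (a + b * l)) (x - l))"
    unfolding lm by auto
  then show ?case by simp
qed

lemma bead_solution_0: "valid_beads b' xs \<Longrightarrow> bead_solution xs t a b 0 = a"
  by (induction b' xs arbitrary: a b rule: valid_beads.induct) (auto simp: order_le_less)

lemma bead_solution_eq: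
  "valid_beads b' xs \<Longrightarrow> bead_solution xs t a b x
     = a + b * x + t * bead_sum xs (\<lambda>s. (x - s) * bead_solution xs t a b s) x"
proof (induction b' xs arbitrary: a b x rule: valid_beads.induct)
  case (2 b' l m r)
  show ?case
  proof (cases "x < l")
    case False
    have ok: "valid_beads True r" using 2(2) by simp
    define A where "A = a + b * l"
    define B where "B = b + t * m * A"
    have at_l: "bead_solution ((l, m) # r) t a b l = A" using bead_solution_0[OF ok] by (simp add: A_def)
    have "bead_sum r (\<lambda>s. (x - (s + l)) * bead_solution ((l, m) # r) t a b (s + l)) (x - l)
        = bead_sum r (\<lambda>s. (x - l - s) * bead_solution r t A B s) (x - l)"
      by (rule bead_sum_cong[OF ok]) (simp add: A_def B_def algebra_simps)
    then have "a + b * x + t * bead_sum ((l, m) # r) (\<lambda>s. (x - s) * bead_solution ((l, m) # r) t a b s) x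
       = a + b * x + t * (m * ((x - l) * A)) + t * bead_sum r (\<lambda>s. (x - l - s) * bead_solution r t A B s) (x - l)"
      using False at_l by (simp only: bead_sum.simps if_False) (simp add: algebra_simps)
    also have "a + b * x + t * (m * ((x - l) * A)) = A + B * (x - l)"
      by (simp add: A_def B_def algebra_simps)
    also have "A + B * (x - l) + t * bead_sum r (\<lambda>s. (x - l - s) * bead_solution r t A B s) (x - l) = bead_solution r t A B (x - l)"
      using 2(1)[OF ok, of A B "x - l"] by simp
    also have "\<dots> = bead_solution ((l, m) # r) t a b x" using False by (simp add: A_def B_def)
    finally show ?thesis by simp
  qed simp
qed simp

lemma bead_string_solution:
  assumes ok: "valid_beads b' xs"
  shows "string_solution (bead_string xs e) a b (- t) (bead_solution xs t a b)"
  unfolding string_solution_def string_length_bead_string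
proof (intro allI impI conjI)
  fix x :: real assume x: "0 \<le> x" "ennreal x < beads_length xs e"
  have m: "(\<lambda>s. (x - s) * bead_solution xs t a b s) \<in> borel_measurable borel"
    using bead_solution_measurable[of xs t a b] by (intro borel_measurable_times) simp_all
  show "set_integrable (string_measure (bead_string xs e) x) {0..x} (\<lambda>s. (x - s) * bead_solution xs t a b s)"
    by (rule bead_string_integrable[OF ok x m])
  show "bead_solution xs t a b x = a + b * x - - t *
      (LINT s:{0..x}|string_measure (bead_string xs e) x. (x - s) * bead_solution xs t a b s)"
    unfolding bead_string_integral[OF ok x m] using bead_solution_eq[OF ok, of t a b x] by simp
qed

text \<open>
  The value at the end of the string of the solution with initial data \<open>a\<close>, \<open>b\<close>, and its final slope
  if the string is infinite. In both cases the limit of \<open>\<psi>/\<phi>\<close> is the quotient of the end values.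
\<close>

fun end_value :: "(real \<times> real) list \<Rightarrow> real option \<Rightarrow> real \<Rightarrow> real \<Rightarrow> real \<Rightarrow> real" where
  "end_value [] (Some e) t a b = a + b * e"
| "end_value [] None t a b = b"
| "end_value ((l, m) # r) e t a b = end_value r e t (a + b * l) (b + t * m * (a + b * l))"

text \<open>
  The reciprocal of the characteristic function at \<open>-t\<close>. It is used in place of the characteristic
  function because the latter is infinite, and the admittance \<open>0\<close>, for the massless infinite string at
  which the recursion may end.
\<close>

fun admittance :: "(real \<times> real) list \<Rightarrow> real option \<Rightarrow> real \<Rightarrow> real" where
  "admittance [] (Some e) t = 1 / e"
| "admittance [] None t = 0"
| "admittance ((l, m) # r) e t = (t * m + admittance r e t) / (1 + l * (t * m + admittance r e t))"

lemma end_value_linear: "end_value xs e t a b = a * end_value xs e t 1 0 + b * end_value xs e t 0 1"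
proof (induction xs arbitrary: a b)
  case Nil
  then show ?case by (cases e) auto
next
  case (Cons lm r)
  obtain l m where lm: "lm = (l, m)" by force
  have step: "end_value (lm # r) e t a b = (a + b * l) * end_value r e t 1 0 + (b + t * m * (a + b * l)) * end_value r e t 0 1"
    for a b unfolding lm end_value.simps by (rule Cons)
  show ?case unfolding step by (simp add: algebra_simps)
qed

text \<open>
  Solutions are linear in the initial data, so prefixing a piece \<open>(l, m)\<close> multiplies the vector of end values
  by a transfer matrix; on quotients this is one step of the continued fraction.
\<close>

lemma admittance_eq_end_value_ratio:
  assumes "0 < t" "valid_beads b xs" "\<And>l. e = Some l \<Longrightarrow> 0 < l"
  shows "0 < end_value xs e t 0 1" "0 \<le> admittance xs e t"
    and "end_value xs e t 1 0 = admittance xs e t * end_value xs e t 0 1"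
proof -
  have "0 < end_value xs e t 0 1 \<and> 0 \<le> admittance xs e t \<and>
      end_value xs e t 1 0 = admittance xs e t * end_value xs e t 0 1"
    using assms(2)
  proof (induction b xs rule: valid_beads.induct)
    case (1 b)
    then show ?case using assms(3) by (cases e) (auto intro: less_imp_le)
  next
    case (2 b l m r)
    define q where "q = end_value r e t 0 1"
    define v where "v = t * m + admittance r e t"
    have q: "0 < q" and r: "0 \<le> admittance r e t" "end_value r e t 1 0 = admittance r e t * q"
      using 2 by (auto simp: q_def)
    have l: "0 \<le> l" and m: "0 < m" using 2(2) by auto
    have v: "0 < v" using assms(1) m r by (simp add: v_def add_pos_nonneg)
    have lv: "0 < 1 + l * v" using v l by (simp add: add_pos_nonneg)
    have e1: "end_value ((l, m) # r) e t 0 1 = q * (1 + l * v)"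
      unfolding end_value.simps end_value_linear[of r e t "0 + 1 * l"] r(2) q_def[symmetric] by (simp add: v_def algebra_simps)
    have e0: "end_value ((l, m) # r) e t 1 0 = q * v"
      unfolding end_value.simps end_value_linear[of r e t "1 + 0 * l"] r(2) q_def[symmetric] by (simp add: v_def algebra_simps)
    have a: "admittance ((l, m) # r) e t = v / (1 + l * v)" by (simp add: v_def)
    show ?case unfolding e1 e0 a using q v lv by simp
  qed
  then show "0 < end_value xs e t 0 1" "0 \<le> admittance xs e t"
    "end_value xs e t 1 0 = admittance xs e t * end_value xs e t 0 1" by auto
qed

lemma admittance_pos:
  assumes "0 < t" "valid_beads b xs" "valid_end xs e"
  shows "0 < admittance xs e t"
proof (cases xs)
  case Nil
  then show ?thesis using assms(3) by (cases e) (auto simp: valid_end_def)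
next
  case (Cons lm r)
  obtain l m where lm: "lm = (l, m)" by force
  have "0 \<le> admittance r e t"
    by (rule admittance_eq_end_value_ratio(2)[OF assms(1), of True])
      (use assms Cons lm in \<open>auto simp: valid_end_def\<close>)
  moreover have "0 \<le> l" "0 < m" using assms(2) Cons lm by auto
  ultimately have "0 < t * m + admittance r e t" "0 \<le> l" using assms(1) by (simp_all add: add_pos_nonneg)
  then show ?thesis unfolding Cons lm by (simp add: add_pos_nonneg)
qed

lemma bead_solution_beyond_last:
  "valid_beads b' xs \<Longrightarrow> sum_list (map fst xs) \<le> x \<Longrightarrow>
   bead_solution xs t a b x = end_value xs (Some 0) t a b + end_value xs None t a b * (x - sum_list (map fst xs))"
proof (induction b' xs arbitrary: a b x rule: valid_beads.induct)
  case (2 b' l m r)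
  have "0 \<le> sum_list (map fst r)" using 2(2) by (intro total_bead_length_nonneg[of True]) simp
  then have "l \<le> x" using 2(3) by simp
  then show ?case using 2 by (simp add: diff_diff_eq)
qed simp

lemma end_value_Some: "end_value xs (Some e) t a b = end_value xs (Some 0) t a b + end_value xs None t a b * e"
  by (induction xs arbitrary: a b) auto

lemma filterlim_enn2real_at_top: "filterlim enn2real at_top (at_left \<infinity>)"
  unfolding filterlim_at_top
proof
  fix c :: real
  have "eventually (\<lambda>y. max c 0 \<le> enn2real y \<and> ennreal (enn2real y) = y \<and> y < \<infinity>) (at_left \<infinity>)"
    by (rule eventually_at_left_ennreal_between) auto
  then show "eventually (\<lambda>y. c \<le> enn2real y) (at_left \<infinity>)" by eventually_elim simp
qed

lemma tendsto_linear_ratio_at_top: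
  fixes A B C D T :: real
  assumes "D \<noteq> 0"
  shows "((\<lambda>x. (A + B * (x - T)) / (C + D * (x - T))) \<longlongrightarrow> B / D) at_top"
proof -
  have "((\<lambda>x. (A + B * (x - T)) / (C + D * (x - T))) \<longlongrightarrow> B * inverse D) at_top"
    using assms by real_asymp
  then show ?thesis by (simp only: divide_inverse)
qed

lemma bead_string_ratio_limit:
  assumes t: "0 < t" and ok: "valid_beads b xs" "valid_end xs e"
  shows "((\<lambda>x. bead_solution xs t 0 1 (enn2real x) / bead_solution xs t 1 0 (enn2real x))
    \<longlongrightarrow> 1 / admittance xs e t) (at_left (beads_length xs e))"
proof -
  let ?T = "sum_list (map fst xs)"
  have T: "0 \<le> ?T" by (rule total_bead_length_nonneg[OF ok(1)])
  define A B C D where "A = end_value xs (Some 0) t 0 1" and "B = end_value xs None t 0 1"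
    and "C = end_value xs (Some 0) t 1 0" and "D = end_value xs None t 1 0"
  have E: "end_value xs e t 1 0 = admittance xs e t * end_value xs e t 0 1" "0 < end_value xs e t 0 1"
    by (rule admittance_eq_end_value_ratio[OF t ok(1)], use ok(2) in \<open>simp add: valid_end_def\<close>)+
  have V: "0 < admittance xs e t" by (rule admittance_pos[OF t ok])
  have E0: "0 < end_value xs e t 1 0" unfolding E(1) using E(2) V by simp
  have val: "end_value xs e t 0 1 / end_value xs e t 1 0 = 1 / admittance xs e t" unfolding E(1) using E(2) by simp
  have "ennreal ?T < beads_length xs e"
    using ok(2) T by (cases e) (auto simp: valid_end_def ennreal_less_iff simp del: ennreal_plus)
  from eventually_at_left_ennreal_between[OF this T]
  have ev: "eventually (\<lambda>x. (A + B * (enn2real x - ?T)) / (C + D * (enn2real x - ?T))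
      = bead_solution xs t 0 1 (enn2real x) / bead_solution xs t 1 0 (enn2real x)) (at_left (beads_length xs e))"
    by eventually_elim (simp add: bead_solution_beyond_last[OF ok(1)] A_def B_def C_def D_def)
  have "((\<lambda>x. (A + B * (enn2real x - ?T)) / (C + D * (enn2real x - ?T)))
     \<longlongrightarrow> end_value xs e t 0 1 / end_value xs e t 1 0) (at_left (beads_length xs e))"
  proof (cases e)
    case None
    have "((\<lambda>x. (A + B * (x - ?T)) / (C + D * (x - ?T))) \<longlongrightarrow> B / D) at_top"
      by (rule tendsto_linear_ratio_at_top) (use E0 None in \<open>simp add: D_def\<close>)
    from filterlim_compose[OF this filterlim_enn2real_at_top] show ?thesis
      by (simp add: None B_def D_def)
  next
    case (Some l)
    have l: "0 < l" using ok(2) Some by (simp add: valid_end_def)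
    have "((\<lambda>x. x) \<longlongrightarrow> ennreal (?T + l)) (at_left (ennreal (?T + l)))" by (rule tendsto_ident_at)
    then have e2: "(enn2real \<longlongrightarrow> ?T + l) (at_left (ennreal (?T + l)))"
      by (rule tendsto_enn2real) (use T l in simp)
    have lim: "((\<lambda>x. (A + B * (enn2real x - ?T)) / (C + D * (enn2real x - ?T)))
        \<longlongrightarrow> (A + B * (?T + l - ?T)) / (C + D * (?T + l - ?T))) (at_left (ennreal (?T + l)))"
    proof (intro tendsto_divide tendsto_add tendsto_mult tendsto_diff tendsto_const e2)
      show "C + D * (?T + l - ?T) \<noteq> 0"
        using E0 Some by (simp add: C_def D_def end_value_Some[of xs l])
    qed
    then show ?thesis
      using Some by (simp add: A_def B_def C_def D_def end_value_Some[of xs l])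
  qed
  then show ?thesis unfolding val by (rule Lim_transform_eventually[OF _ ev])
qed

theorem bead_string_characteristic_function:
  assumes ok: "valid_beads b xs" "valid_end xs e"
    and hol: "W holomorphic_on - (complex_of_real ` {0..})"
    and W: "\<And>t. 0 < t \<Longrightarrow> W (complex_of_real (- t)) = complex_of_real (1 / admittance xs e t)"
  shows "has_characteristic_function (bead_string xs e) W"
  unfolding has_characteristic_function_def string_length_bead_string
proof (intro conjI hol allI impI)
  fix z :: real assume z: "z < 0"
  define t where "t = - z"
  have t: "0 < t" "z = - t" using z by (simp_all add: t_def)
  have "string_solution (bead_string xs e) 1 0 z (bead_solution xs t 1 0)"
    "string_solution (bead_string xs e) 0 1 z (bead_solution xs t 0 1)"
    unfolding t(2) by (rule bead_string_solution[OF ok(1)])+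
  moreover have "((\<lambda>x. complex_of_real (bead_solution xs t 0 1 (enn2real x) / bead_solution xs t 1 0 (enn2real x)))
      \<longlongrightarrow> W (complex_of_real z)) (at_left (beads_length xs e))"
    unfolding t(2) W[OF t(1)] by (intro tendsto_of_real bead_string_ratio_limit[OF t(1) ok])
  ultimately show "if beads_length xs e = 0 then W (complex_of_real z) = 0
    else \<exists>\<phi> \<psi>. string_solution (bead_string xs e) 1 0 z \<phi> \<and> string_solution (bead_string xs e) 0 1 z \<psi> \<and>
      ((\<lambda>x. complex_of_real (\<psi> (enn2real x) / \<phi> (enn2real x))) \<longlongrightarrow> W (complex_of_real z)) (at_left (beads_length xs e))"
    using beads_length_pos[OF ok] by auto
qed

section \<open>Continued fractions\<close>

text \<open>
  For \<open>c = 1\<close> this is the operation \<open>W \<mapsto> 1/(s + 1/W)\<close>. It corresponds to the change of variable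
  \<open>x \<mapsto> x/(1 + s x)\<close>; after a piece of length \<open>l\<close> the remaining string is transformed in the same way with
  \<open>1 + s x\<close> started at \<open>c' = c + s l\<close> instead of \<open>c\<close>, which is why the parameter \<open>c\<close> is needed for the
  induction. Since \<open>s > 0\<close>, the image has finite length.
\<close>

lemma admittance_affine_transform:
  assumes "valid_beads b xs" "\<And>l. e = Some l \<Longrightarrow> 0 < l" "0 < c" "0 < s"
  shows "\<exists>ys l'. valid_beads b ys \<and> 0 < l' \<and>
    (\<forall>t>0. admittance ys (Some l') t = c\<^sup>2 * admittance xs e t + s * c)"
  using assms(1,3)
proof (induction b xs arbitrary: c rule: valid_beads.induct)
  case (1 b)
  show ?case
  proof (cases e)
    case None
    then show ?thesis using 1 assms(4) by (intro exI[of _ "[]"] exI[of _ "1 / (s * c)"]) auto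
  next
    case (Some l)
    then have l: "0 < l" using assms(2) by simp
    then have "0 < c + s * l" using 1 assms(4) by (simp add: add_pos_pos)
    then have "1 / (l / (c * (c + s * l))) = c\<^sup>2 * (1 / l) + s * c"
      using l 1 by (simp add: field_simps power2_eq_square)
    then show ?thesis using Some 1 l \<open>0 < c + s * l\<close>
      by (intro exI[of _ "[]"] exI[of _ "l / (c * (c + s * l))"]) auto
  qed
next
  case (2 b l m r)
  have l: "0 \<le> l" "b \<Longrightarrow> l \<noteq> 0" and m: "0 < m" and r: "valid_beads True r" using 2(2) by auto
  define c' where "c' = c + s * l"
  have c: "0 < c" and c': "0 < c'" using 2(3) l assms(4) by (auto simp: c'_def add_pos_nonneg)
  obtain ys l' where ys: "valid_beads True ys" "0 < l'"
     "\<And>t. 0 < t \<Longrightarrow> admittance ys (Some l') t = c'\<^sup>2 * admittance r e t + s * c'"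
    using 2(1)[OF r c'] by blast
  have "admittance ((l / (c * c'), m * c'\<^sup>2) # ys) (Some l') t = c\<^sup>2 * admittance ((l, m) # r) e t + s * c"
    if t: "0 < t" for t
  proof -
    define v where "v = t * m + admittance r e t"
    have v: "0 < v"
      using admittance_eq_end_value_ratio(2)[OF t r, of e] assms(2) t m unfolding v_def by (simp add: add_pos_nonneg)
    have lv: "0 < 1 + l * v" using v l by (simp add: add_pos_nonneg)
    have v': "t * (m * c'\<^sup>2) + (c'\<^sup>2 * admittance r e t + s * c') = c' * (c' * v + s)"
      by (simp add: v_def power2_eq_square algebra_simps)
    have "1 + l / (c * c') * (c' * (c' * v + s)) = c' * (1 + l * v) / c"
      using c c' by (simp add: field_simps) (simp add: c'_def algebra_simps)
    then have "admittance ((l / (c * c'), m * c'\<^sup>2) # ys) (Some l') t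
       = c' * (c' * v + s) / (c' * (1 + l * v) / c)"
      by (simp only: admittance.simps ys(3)[OF t] v')
    also have "\<dots> = c * (c' * v + s) / (1 + l * v)" using c' by simp
    also have "\<dots> = c\<^sup>2 * (v / (1 + l * v)) + s * c"
      using lv by (simp add: field_simps) (simp add: c'_def power2_eq_square algebra_simps)
    finally show ?thesis by (simp add: v_def)
  qed
  moreover have "valid_beads b ((l / (c * c'), m * c'\<^sup>2) # ys)" using l m c c' ys by auto
  ultimately show ?case using ys(2) by blast
qed

text \<open>
  In terms of \<open>W\<close>, the reciprocal of the admittance, this is \<open>W \<mapsto> c\<^sup>2 W + s c / t\<close>: for \<open>c = 1\<close> the term \<open>s/(-z)\<close> is
  added. It is the dual of the previous transformation, with lengths and masses exchanged, and \<open>c\<close>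
  follows the value of \<open>1 + s M\<close>. A finite last piece becomes a piece followed by a bead and an
  infinite end, since \<open>W(z)\<close> now has a pole at \<open>z = 0\<close>. The formula avoids dividing by the admittance, which may be \<open>0\<close>.
\<close>

lemma impedance_affine_transform:
  assumes "valid_beads b xs" "\<And>l. e = Some l \<Longrightarrow> 0 < l" "0 < c" "0 < s"
  shows "\<exists>ys. valid_beads b ys \<and> (valid_end xs e \<longrightarrow> ys \<noteq> []) \<and>
    (\<forall>t>0. admittance ys None t = admittance xs e t / (c\<^sup>2 + s * c * admittance xs e t / t))"
  using assms(1,3)
proof (induction b xs arbitrary: c rule: valid_beads.induct)
  case (1 b)
  show ?case
  proof (cases e)
    case None
    then show ?thesis by (intro exI[of _ "[]"]) (simp add: valid_end_def)
  next
    case (Some l)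
    then have l: "0 < l" using assms(2) by simp
    have "admittance [(c\<^sup>2 * l, 1 / (s * c))] None t = (1 / l) / (c\<^sup>2 + s * c * (1 / l) / t)" if "0 < t" for t
    proof -
      have "0 < s * c + c\<^sup>2 * l * t"
        using l 1 assms(4) that by (simp_all add: add_pos_pos)
      then show ?thesis using l 1 assms(4) that by (simp add: divide_simps)
    qed
    then show ?thesis using Some 1 l assms(4)
      by (intro exI[of _ "[(c\<^sup>2 * l, 1 / (s * c))]"]) auto
  qed
next
  case (2 b l m r)
  have l: "0 \<le> l" "b \<Longrightarrow> l \<noteq> 0" and m: "0 < m" and r: "valid_beads True r" using 2(2) by auto
  define c' where "c' = c + s * m"
  have s: "0 < s" by fact
  have c: "0 < c" and c': "0 < c'" using 2(3) m s by (auto simp: c'_def add_pos_pos)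
  obtain ys where ys: "valid_beads True ys"
     "\<And>t. 0 < t \<Longrightarrow> admittance ys None t = admittance r e t / (c'\<^sup>2 + s * c' * admittance r e t / t)"
    using 2(1)[OF r c'] by blast
  have "admittance ((c\<^sup>2 * l, m / (c * c')) # ys) None t
      = admittance ((l, m) # r) e t / (c\<^sup>2 + s * c * admittance ((l, m) # r) e t / t)"
    if t: "0 < t" for t
  proof -
    define z where "z = admittance r e t"
    have z: "0 \<le> z"
      using admittance_eq_end_value_ratio(2)[OF t r, of e] assms(2) unfolding z_def by simp
    define y where "y = t * m + z"
    have y: "0 < y" using z t m by (simp add: y_def add_pos_nonneg)
    have d1: "0 < c' * t + s * z" using c' t s z by (simp add: add_pos_nonneg)
    have d: "c * t + s * y = c' * t + s * z" by (simp add: y_def c'_def algebra_simps)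
    have d2: "0 < 1 + l * y" using y l by (simp add: add_pos_nonneg)
    have "z / (c'\<^sup>2 + s * c' * z / t) = t * z / (c' * (c' * t + s * z))"
    proof -
      have "c'\<^sup>2 + s * c' * z / t = c' * (c' * t + s * z) / t"
        using t by (simp add: field_simps power2_eq_square)
      then show ?thesis by simp
    qed
    moreover have frac: "t * (m / (c * c')) + t * z / (c' * D) = (t * m * D + t * z * c) / (c * c' * D)" if "0 < D" for D
      using that c c' by (simp add: field_simps)
    ultimately have "t * (m / (c * c')) + z / (c'\<^sup>2 + s * c' * z / t)
       = (t * m * (c' * t + s * z) + t * z * c) / (c * c' * (c' * t + s * z))"
      using c c' d1 frac[of "c' * t + s * z"] by simp
    also have "t * m * (c' * t + s * z) + t * z * c = c' * (t * y)"
      by (simp add: y_def c'_def algebra_simps)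
    also have "c' * (t * y) / (c * c' * (c' * t + s * z)) = t * y / (c * (c * t + s * y))"
      using c c' unfolding d by simp
    finally have v: "t * (m / (c * c')) + z / (c'\<^sup>2 + s * c' * z / t) = t * y / (c * (c * t + s * y))" .
    have d3: "0 < c * t + s * y" unfolding d by (rule d1)
    have "0 < c * (c * t + s * y) + c\<^sup>2 * l * (t * y)"
      using c d3 l y t by (intro add_pos_nonneg) simp_all
    moreover have "1 + c\<^sup>2 * l * (t * y / (c * (c * t + s * y)))
       = (c * (c * t + s * y) + c\<^sup>2 * l * (t * y)) / (c * (c * t + s * y))"
      using c d3 by (simp add: add_divide_distrib)
    ultimately have lhs: "t * y / (c * (c * t + s * y)) / (1 + c\<^sup>2 * l * (t * y / (c * (c * t + s * y))))
       = t * y / (c * (c * t + s * y) + c\<^sup>2 * l * (t * y))"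
      using c d3 by simp
    have "c\<^sup>2 + s * c * (y / (1 + l * y)) / t = (c * (c * t + s * y) + c\<^sup>2 * l * (t * y)) / (t * (1 + l * y))"
    proof -
      have "c\<^sup>2 + s * c * (y / D) / t = (c * (c * t * D + s * y)) / (t * D)" if "0 < D" for D
        using that t by (simp add: field_simps power2_eq_square)
      from this[OF d2] show ?thesis by (simp add: algebra_simps power2_eq_square)
    qed
    then have rhs: "(y / (1 + l * y)) / (c\<^sup>2 + s * c * (y / (1 + l * y)) / t)
       = t * y / (c * (c * t + s * y) + c\<^sup>2 * l * (t * y))"
      using d2 t by simp
    show ?thesis
      by (simp only: admittance.simps ys(2)[OF t] z_def[symmetric] v y_def[symmetric] lhs rhs)
  qed
  moreover have "valid_beads b ((c\<^sup>2 * l, m / (c * c')) # ys)" using l m c c' ys by auto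
  ultimately show ?case by blast
qed

text \<open>
  A single coefficient must be positive, as \<open>W[0]\<close> would be the function \<open>0\<close>, whose string has length \<open>0\<close>.
\<close>

definition valid_cfrac :: "real list \<Rightarrow> bool" where
  "valid_cfrac ss \<longleftrightarrow> ss \<noteq> [] \<and> 0 \<le> hd ss \<and> (\<forall>x\<in>set (tl ss). 0 < x) \<and> (tl ss = [] \<longrightarrow> 0 < hd ss)"

text \<open>
  The fraction is \<open>a/t + 1/(b + 1/W)\<close> with a shorter fraction \<open>W\<close>, so it is obtained by the two
  transformations; a leading coefficient \<open>a = 0\<close>, possible only at the very beginning, makes the second one trivial.
\<close>

lemma cfrac_bead_string:
  "valid_cfrac ss \<Longrightarrow> \<exists>xs e. valid_beads False xs \<and> valid_end xs e \<and>
     (\<forall>t>0. cfrac_W ss (complex_of_real (- t)) = complex_of_real (1 / admittance xs e t))"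
proof (induction ss "0 :: complex" rule: cfrac_W.induct)
  case (1 a)
  then show ?case
    by (intro exI[of _ "[(0, 1 / a)]"] exI[of _ None]) (auto simp: valid_cfrac_def valid_end_def)
next
  case (2 a b)
  then have b: "0 < b" and a: "0 \<le> a" by (auto simp: valid_cfrac_def)
  show ?case
  proof (cases "a = 0")
    case True
    then show ?thesis using b
      by (intro exI[of _ "[]"] exI[of _ "Some (1 / b)"]) (auto simp: valid_end_def)
  next
    case False
    then have "complex_of_real (a / t + 1 / b) = complex_of_real (1 / admittance [(1 / b, 1 / a)] None t)" if "0 < t" for t
      using a b that by (simp add: divide_simps) 
    then show ?thesis using a b False
      by (intro exI[of _ "[(1 / b, 1 / a)]"] exI[of _ None]) (auto simp: valid_end_def)
  qed
next
  case (3 a b c cs)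
  then have b: "0 < b" and a: "0 \<le> a" and ok: "valid_cfrac (c # cs)" by (auto simp: valid_cfrac_def)
  obtain xs e where xs: "valid_beads False xs" "valid_end xs e"
    "\<And>t. 0 < t \<Longrightarrow> cfrac_W (c # cs) (complex_of_real (- t)) = complex_of_real (1 / admittance xs e t)"
    using 3(1)[OF ok] by blast
  have e: "0 < l" if "e = Some l" for l using xs(2) that by (simp add: valid_end_def)
  obtain ys l' where ys: "valid_beads False ys" "0 < l'" "\<And>t. 0 < t \<Longrightarrow> admittance ys (Some l') t = admittance xs e t + b"
    using admittance_affine_transform[of False xs e 1 b, OF xs(1) e zero_less_one b] by auto
  have V: "0 < admittance ys (Some l') t" if "0 < t" for t
    by (rule admittance_pos[OF that ys(1)]) (use ys(2) in \<open>simp add: valid_end_def\<close>)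
  have W: "cfrac_W (a # b # c # cs) (complex_of_real (- t)) = complex_of_real (a / t + 1 / admittance ys (Some l') t)"
    if "0 < t" for t
    using that by (simp add: xs(3)[OF that, simplified] ys(3)[OF that] add.commute)
  show ?case
  proof (cases "a = 0")
    case True
    then show ?thesis using W ys(1,2)
      by (intro exI[of _ ys] exI[of _ "Some l'"]) (simp add: valid_end_def)
  next
    case False
    then have "0 < a" using a by simp
    obtain zs where zs: "valid_beads False zs" "zs \<noteq> []" "\<And>t. 0 < t \<Longrightarrow> admittance zs None t
        = admittance ys (Some l') t / (1 + a * admittance ys (Some l') t / t)"
      using impedance_affine_transform[OF ys(1) _ zero_less_one \<open>0 < a\<close>, of "Some l'"] ys(2) by (auto simp: valid_end_def)
    have "1 / admittance zs None t = a / t + 1 / admittance ys (Some l') t" if "0 < t" for t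
      unfolding zs(3)[OF that] using V[OF that] that by (simp add: field_simps)
    then show ?thesis using W zs(1,2)
      by (intro exI[of _ zs] exI[of _ None]) (simp add: valid_end_def)
  qed
qed (auto simp: valid_cfrac_def)

lemma Re_inverse_positive: "0 < Re w \<Longrightarrow> 0 < Re (inverse w)"
  by (simp add: add_pos_nonneg)

lemma Re_csqrt_uminus_pos:
  assumes "z \<notin> complex_of_real ` {0..}"
  shows "0 < Re (csqrt (- z))"
proof (rule ccontr)
  assume "\<not> 0 < Re (csqrt (- z))"
  then have "Re (csqrt (- z)) = 0" using csqrt_principal[of "- z"] by auto
  then have "csqrt (- z) = \<i> * complex_of_real (Im (csqrt (- z)))" by (simp add: complex_eq_iff)
  then have "(csqrt (- z))\<^sup>2 = - complex_of_real ((Im (csqrt (- z)))\<^sup>2)"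
    by (metis (no_types, lifting) mult_minus1 of_real_power power2_i power_mult_distrib)
  then have "z = complex_of_real ((Im (csqrt (- z)))\<^sup>2)" by (simp add: power2_csqrt)
  then show False using assms by (metis atLeast_iff imageI zero_le_power2)
qed

text \<open>
  The right half-plane is closed under addition and inversion. It contains \<open>q\<close> and \<open>1/q\<close>, hence with
  \<open>q w\<close> also \<open>(b + 1/w)/q\<close>, its inverse, and finally \<open>q\<close> times the next value of the fraction.
\<close>

lemma sector_step:
  fixes q w :: complex
  assumes q: "0 < Re q" and w: "0 < Re (q * w)" and a: "0 \<le> a" and b: "0 < b"
  shows "complex_of_real b + 1 / w \<noteq> 0"
    and "0 < Re (q * (complex_of_real a / q\<^sup>2 + 1 / (complex_of_real b + 1 / w)))"
proof -
  define y where "y = complex_of_real b * inverse q + inverse (q * w)"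
  have q0: "q \<noteq> 0" and w0: "w \<noteq> 0" using q w by auto
  have "0 < Re (complex_of_real b * inverse q)" using Re_inverse_positive[OF q] b by (simp del: inverse_complex.simps)
  then have y: "0 < Re y" using Re_inverse_positive[OF w] by (simp add: y_def)
  have eq: "complex_of_real b + 1 / w = q * y" using q0 w0 by (simp add: y_def field_simps)
  show "complex_of_real b + 1 / w \<noteq> 0" unfolding eq using y q0 by auto
  have "q * (complex_of_real a / q\<^sup>2 + 1 / (q * y)) = complex_of_real a * inverse q + inverse y"
    using q0 y by (simp add: field_simps power2_eq_square)
  moreover have "0 \<le> a * Re (inverse q)" by (intro mult_nonneg_nonneg a less_imp_le[OF Re_inverse_positive[OF q]])
  ultimately show "0 < Re (q * (complex_of_real a / q\<^sup>2 + 1 / (complex_of_real b + 1 / w)))"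
    unfolding eq using Re_inverse_positive[OF y] by simp
qed

lemma cfrac_W_sector:
  "z \<notin> complex_of_real ` {0..} \<Longrightarrow> valid_cfrac ss \<Longrightarrow> 0 < Re (csqrt (- z) * cfrac_W ss z)"
proof (induction ss z rule: cfrac_W.induct)
  case (1 a z)
  define q where "q = csqrt (- z)"
  have q: "0 < Re q" "- z = q\<^sup>2" using Re_csqrt_uminus_pos[OF 1(1)] by (simp_all add: q_def power2_csqrt)
  have "q * (complex_of_real a / q\<^sup>2) = complex_of_real a * inverse q"
    using q(1) by (cases "q = 0") (simp_all add: field_simps power2_eq_square)
  moreover have "0 < a * Re (inverse q)"
    by (intro mult_pos_pos Re_inverse_positive q(1)) (use 1(2) in \<open>simp add: valid_cfrac_def\<close>)
  ultimately show ?case unfolding cfrac_W.simps q_def[symmetric] unfolding q(2)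
    by (simp del: inverse_complex.simps)
next
  case (2 a b z)
  define q where "q = csqrt (- z)"
  have q: "0 < Re q" "- z = q\<^sup>2" using Re_csqrt_uminus_pos[OF 2(1)] by (simp_all add: q_def power2_csqrt)
  have a: "0 \<le> a" and b: "0 < b" using 2(2) by (auto simp: valid_cfrac_def)
  have "q * (complex_of_real a / q\<^sup>2 + 1 / complex_of_real b) = complex_of_real a * inverse q + complex_of_real (1 / b) * q"
    using q(1) by (cases "q = 0") (simp_all add: field_simps power2_eq_square)
  moreover have "0 \<le> a * Re (inverse q)" by (intro mult_nonneg_nonneg a less_imp_le[OF Re_inverse_positive[OF q(1)]])
  moreover have "0 < Re (complex_of_real (1 / b) * q)" using b q(1) by simp
  ultimately show ?case unfolding cfrac_W.simps q_def[symmetric] unfolding q(2)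
    by (simp del: inverse_complex.simps)
next
  case (3 a b c cs z)
  have a: "0 \<le> a" and b: "0 < b" and ok: "valid_cfrac (c # cs)" using 3(3) by (auto simp: valid_cfrac_def)
  have z: "- z = (csqrt (- z))\<^sup>2" by (simp add: power2_csqrt)
  show ?case unfolding cfrac_W.simps
    by (subst (2) z) (rule sector_step(2)[OF Re_csqrt_uminus_pos[OF 3(2)] 3(1)[OF 3(2) ok] a b])
qed (auto simp: valid_cfrac_def)

lemma cfrac_W_holomorphic:
  assumes "valid_cfrac ss"
  shows "cfrac_W ss holomorphic_on - (complex_of_real ` {0..})"
  using assms
proof (induction ss "0 :: complex" rule: cfrac_W.induct)
  case (1 a)
  have "(\<lambda>z. complex_of_real a / (- z)) holomorphic_on - (complex_of_real ` {0..})"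
    by (intro holomorphic_intros) force
  then show ?case by (simp cong: holomorphic_cong)
next
  case (2 a b)
  have "(\<lambda>z. complex_of_real a / (- z) + 1 / complex_of_real b) holomorphic_on - (complex_of_real ` {0..})"
    using 2 by (intro holomorphic_intros) (force simp: valid_cfrac_def)+
  then show ?case by (simp cong: holomorphic_cong)
next
  case (3 a b c cs)
  have a: "0 \<le> a" and b: "0 < b" and ok: "valid_cfrac (c # cs)" using 3(2) by (auto simp: valid_cfrac_def)
  have nz: "z \<noteq> 0 \<and> cfrac_W (c # cs) z \<noteq> 0 \<and> complex_of_real b + 1 / cfrac_W (c # cs) z \<noteq> 0"
    if z: "z \<in> - (complex_of_real ` {0..})" for z
  proof -
    have zn: "z \<notin> complex_of_real ` {0..}" using z by simp
    have pos: "0 < Re (csqrt (- z) * cfrac_W (c # cs) z)" by (rule cfrac_W_sector[OF zn ok])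
    have "z \<noteq> 0" using zn by force
    then show ?thesis using pos sector_step(1)[OF Re_csqrt_uminus_pos[OF zn] pos a b] by auto
  qed
  have "(\<lambda>z. complex_of_real a / (- z) + 1 / (complex_of_real b + 1 / cfrac_W (c # cs) z)) holomorphic_on - (complex_of_real ` {0..})"
    by (intro holomorphic_intros 3(1) ok) (use nz in auto)
  moreover have "cfrac_W (a # b # c # cs) = (\<lambda>z. complex_of_real a / (- z) + 1 / (complex_of_real b + 1 / cfrac_W (c # cs) z))"
    by (rule ext) simp
  ultimately show ?case by simp
qed (auto simp: valid_cfrac_def)

theorem corollary3p1:
  fixes s :: "nat \<Rightarrow> real" and j k :: nat
  assumes "s 0 \<ge> 0" and "\<And>i. i \<ge> 1 \<Longrightarrow> s i > 0"
    and "k > 0" and "j < k"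
  shows "discrete_string (cfrac_M (map s [j..<Suc k]))"
proof -
  define ss where "ss = map s [j..<Suc k]"
  have ss: "ss = s j # map s [Suc j..<Suc k]" using assms(4) by (simp add: ss_def upt_conv_Cons del: upt_Suc)
  have "0 \<le> s j" using assms(1) assms(2)[of j] by (cases "j = 0") auto
  moreover have "\<forall>x\<in>set (map s [Suc j..<Suc k]). 0 < x" using assms(2) by auto
  moreover have "map s [Suc j..<Suc k] \<noteq> []" using assms(4) by simp
  ultimately have ok: "valid_cfrac ss" unfolding ss valid_cfrac_def by simp
  obtain xs e where xs: "valid_beads False xs" "valid_end xs e"
    "\<And>t. 0 < t \<Longrightarrow> cfrac_W ss (complex_of_real (- t)) = complex_of_real (1 / admittance xs e t)"
    using cfrac_bead_string[OF ok] by blast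
  have d: "discrete_string (bead_string xs e)" by (rule bead_string_discrete[OF xs(1,2)])
  have W: "has_characteristic_function (bead_string xs e) (cfrac_W ss)"
    by (rule bead_string_characteristic_function[OF xs(1,2) cfrac_W_holomorphic[OF ok] xs(3)])
  have "string_of (cfrac_W ss) = bead_string xs e"
    unfolding string_of_def
  proof (rule the_equality)
    show "is_string (bead_string xs e) \<and> has_characteristic_function (bead_string xs e) (cfrac_W ss)"
      using d W by (simp add: discrete_string_def)
  qed (use discrete_string_unique[OF _ _ d W] in blast)
  then show ?thesis using d unfolding cfrac_M_def ss_def by simp
qed

end
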